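(* Let $\mathbb{F}$ be an algebraically closed field and $N\ge2$. Let $\sigma_0,\ldots,\sigma_{N-1}\in\mathbb{F}$, let $\xi_1,\ldots,\xi_N\in(\mathbb{F}\cup\{\infty\})\setminus\{0\}$, let $\beta_0,\ldots,\beta_N\in\mathbb{F}$ be nonzero, and let $D_0,\ldots,D_N\in\mathbb{F}^{m\times m}$. Put $$g_i(\lambda)=\beta_i(1-\lambda/\xi_i),\quad h_j(\lambda)=\lambda-\sigma_j,\quad b_0(\lambda)=\frac1{\beta_0},\quad b_i(\lambda)=\frac1{\beta_0}\prod_{k=1}^{i}\frac{h_{k-1}(\lambda)}{g_k(\lambda)},$$ for $i=1,\ldots,N$ and $j=0,\ldots,N-1$, and let $$Q_N(\lambda)=b_0(\lambda)D_0+b_1(\lambda)D_1+\cdots+b_N(\lambda)D_N\in\mathbb{F}(\lambda)^{m\times m},\qquad L_N(\lambda)=\begin{bmatrix} M_N(\lambda) \\ K_N(\lambda) \end{bmatrix},$$ where $$M_N(\lambda)=\begin{bmatrix}\frac{g_N(\lambda)}{\beta_N}D_0&\frac{g_N(\lambda)}{\beta_N}D_1&\cdots&\frac{g_N(\lambda)}{\beta_N}D_{N-2}&\frac{g_N(\lambda)}{\beta_N}D_{N-1}+\frac{h_{N-1}(\lambda)}{\beta_N}D_N\end{bmatrix},$$ $$K_N(\lambda)=\begin{bmatrix}-h_0(\lambda)&g_1(\lambda) \\ &-h_1(\lambda)&g_2(\lambda) \\ &&\ddots&\ddots \\ &&&-h_{N-2}(\lambda)&g_{N-1}(\lambda)\end{bmatrix}\otimes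 I_m.$$ Let $\mathcal{P}_N$ and $i_N$ be, respectively, the set of finite poles and the number of infinite poles in the list $(\xi_1,\ldots,\xi_N)$. Then: (a) $L_N(\lambda)$, partitioned into the block rows $M_N(\lambda)$ (in the role of $M(\lambda)$) and $K_N(\lambda)$ (in the role of $K(\lambda)$), is a block full rank pencil with only one block column associated with $Q_N(\lambda)$ in $\mathbb{F}\setminus\mathcal{P}_N$. (b) $L_N(\lambda)$ is a linearization with empty state matrix of $Q_N(\lambda)$ in $\mathbb{F}\setminus\mathcal{P}_N$. (c) $L_N(\lambda)$ is a linearization with empty state matrix of $Q_N(\lambda)$ at $\infty$ of grade $i_N$.
   Context: Conventions: $\lambda/\xi_i:=0$ if $\xi_i=\infty$. The elements $\xi_i$ are called poles; $\mathcal{P}_N=\{\xi_i:\xi_i\ne\infty\}$ and $i_N=\#\{i:\xi_i=\infty\}$ (counted with repetition). The poles are not assumed distinct from the nodes $\sigma_j$. For a rational matrix $R(\lambda)$ and an integer $g$, $\operatorname{rev}_gR(\lambda):=\lambda^gR(1/\lambda)$. A pencil is a polynomial matrix of degree at most $1$. A rational matrix $R(\lambda)$ with $p$ rows has full row rank in $\Omega\subseteq\mathbb{F}$ if, for all $\lambda_0\in\Omega$, no entry of $R$ has a pole at $\lambda_0$ and $\operatorname{rank}R(\lambda_0)=p$. A square rational matrix is regular at $\lambda_0$ if no entry has a pole at $\lambda_0$ and its determinant is nonzero at $\lambda_0$. A block full rank pencil with only one block column is a pencil $L(\lambda)=\begin{bmatrix} M(\lambda) \\ K(\lambda) \end{bmatrix}$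 with $K(\lambda)$ of full row normal rank (full row rank over $\mathbb{F}(\lambda)$). A rational basis $N(\lambda)$ dual to $K(\lambda)\in\mathbb{F}(\lambda)^{p\times k}$ is a rational matrix of size $(k-p)\times k$ with full row normal rank and $K(\lambda)N(\lambda)^T=0$. Such a pencil $L(\lambda)$ is said to be associated with a rational matrix $G(\lambda)$ in $\Omega\subseteq\mathbb{F}$ if there is a rational basis $N(\lambda)$ dual to $K(\lambda)$ and a square rational matrix $N_2(\lambda)$ regular at every point of $\Omega$ (for instance the identity) such that $K(\lambda)$ and $N(\lambda)$ have full row rank in $\Omega$ and $G(\lambda)=N_2(\lambda)M(\lambda)N(\lambda)^T$. A pencil $L(\lambda)\in\mathbb{F}[\lambda]^{q\times r}$ is a linearization with empty state matrix of $G(\lambda)\in\mathbb{F}(\lambda)^{p\times m}$ in $\Omega\subseteq\mathbb{F}$ if for each $\lambda_0\in\Omega$ there exist integers $s_1,s_2\ge0$ with $s_1-s_2=q-p=r-m$ and rational matrices $R_1,R_2$ regular at $\lambda_0$, of sizes $p+s_1$ and $m+s_1$, such that $R_1\,\mathrm{diag}(G,I_{s_1})\,R_2=\mathrm{diag}(L,I_{s_2})$. It is a linearization with empty state matrix of $G(\lambda)$ at $\infty$ of grade $g$ if there exist integers $s_1,s_2\ge0$ with $s_1-s_2=q-p=r-m$ and rational matrices $Q_1,Q_2$ regular at $0$, of sizes $p+s_1$ and $m+s_1$, such that $Q_1\,\mathrm{diag}(\operatorname{rev}_gG,I_{s_1})\,Q_2=\mathrm{diag}(\operatorname{rev}_\ell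 L,I_{s_2})$, where $\ell=\deg L(\lambda)$. *)

theory Defs
  imports
    "HOL-Computational_Algebra.Computational_Algebra"
    "Jordan_Normal_Form.DL_Rank"
begin

hide_const (open) Module.smult

section \<open>Rational functions and rational matrices\<close>

text \<open>
  The field of rational functions over a field \<open>'a\<close> is \<open>'a poly fract\<close>. A rational function has no
  pole at \<open>x\<close> if it can be written as a fraction whose denominator does not vanish at \<open>x\<close>; its
  value there does not depend on the fraction, see \<open>rat_eval_Fract\<close> below.
\<close>

definition has_pole_at :: "'a :: field poly fract \<Rightarrow> 'a \<Rightarrow> bool" where
  "has_pole_at r x \<longleftrightarrow> \<not> (\<exists>p q. r = Fract p q \<and> poly q x \<noteq> 0)"

definition rat_eval :: "'a :: field poly fract \<Rightarrow> 'a \<Rightarrow> 'a" where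
  "rat_eval r x = (THE v. \<exists>p q. r = Fract p q \<and> poly q x \<noteq> 0 \<and> v = poly p x / poly q x)"

lemma rat_eval_Fract:
  fixes p q :: "'a :: field poly"
  assumes "poly q x \<noteq> 0"
  shows "rat_eval (Fract p q) x = poly p x / poly q x"
  unfolding rat_eval_def
proof (rule the_equality)
  show "\<exists>p' q'. Fract p q = Fract p' q' \<and> poly q' x \<noteq> 0 \<and> poly p x / poly q x = poly p' x / poly q' x"
    using assms by blast
next
  fix v
  assume "\<exists>p' q'. Fract p q = Fract p' q' \<and> poly q' x \<noteq> 0 \<and> v = poly p' x / poly q' x"
  then obtain p' q' where *: "Fract p q = Fract p' q'" "poly q' x \<noteq> 0" "v = poly p' x / poly q' x"
    by blast
  from assms *(2) have "q \<noteq> 0" "q' \<noteq> 0" by auto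
  with *(1) have "p * q' = p' * q" by (simp add: eq_fract)
  hence "poly p x * poly q' x = poly p' x * poly q x" by (metis poly_mult)
  with assms *(2,3) show "v = poly p x / poly q x" by (simp add: frac_eq_eq)
qed

definition rat_const :: "'a :: field \<Rightarrow> 'a poly fract" where
  "rat_const c = to_fract [:c:]"

definition rat_var :: "'a :: field poly fract" where
  "rat_var = to_fract [:0, 1:]"

definition poly_at_rat :: "'a :: field poly \<Rightarrow> 'a poly fract \<Rightarrow> 'a poly fract" where
  "poly_at_rat p s = poly (map_poly rat_const p) s"

text \<open>\<open>rat_recip r\<close> is \<open>r(1/\<lambda>)\<close>; independence of the chosen fraction is \<open>rat_recip_Fract\<close> below.\<close>

definition rat_recip :: "'a :: field poly fract \<Rightarrow> 'a poly fract" where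
  "rat_recip r = (THE s. \<exists>p q. r = Fract p q \<and> q \<noteq> 0 \<and>
     s = poly_at_rat p (inverse rat_var) / poly_at_rat q (inverse rat_var))"

lemma rat_const_0 [simp]: "rat_const 0 = 0"
  by (simp add: rat_const_def)

lemma rat_const_add: "rat_const (a + b) = rat_const a + rat_const b"
  by (simp add: rat_const_def flip: to_fract_add)

lemma rat_const_mult: "rat_const (a * b) = rat_const a * rat_const b"
  by (simp add: rat_const_def flip: to_fract_mult)

lemma rat_var_nonzero [simp]: "rat_var \<noteq> 0"
  by (simp add: rat_var_def)

lemma poly_at_rat_0 [simp]: "poly_at_rat 0 s = 0"
  by (simp add: poly_at_rat_def)

lemma poly_at_rat_pCons: "poly_at_rat (pCons a p) s = rat_const a + s * poly_at_rat p s"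
  by (simp add: poly_at_rat_def map_poly_pCons)

lemma poly_at_rat_add: "poly_at_rat (p + q) s = poly_at_rat p s + poly_at_rat q s"
  by (induction p q rule: poly_induct2)
     (simp_all add: poly_at_rat_pCons rat_const_add algebra_simps)

lemma poly_at_rat_smult: "poly_at_rat (smult a p) s = rat_const a * poly_at_rat p s"
  by (induction p) (simp_all add: poly_at_rat_pCons rat_const_mult algebra_simps)

lemma poly_at_rat_mult: "poly_at_rat (p * q) s = poly_at_rat p s * poly_at_rat q s"
  by (induction p)
     (simp_all add: poly_at_rat_pCons poly_at_rat_add poly_at_rat_smult algebra_simps)

lemma poly_at_rat_inverse_var:
  "rat_var ^ degree p * poly_at_rat p (inverse rat_var) = to_fract (reflect_poly p)"
proof (induction p)
  case (pCons a p)
  show ?case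
  proof (cases "p = 0")
    case True
    thus ?thesis by (simp add: poly_at_rat_pCons rat_const_def)
  next
    case False
    have mon: "to_fract (monom a n) = rat_const a * rat_var ^ n" for n
    proof (induction n)
      case 0
      show ?case by (simp add: rat_const_def monom_0)
    next
      case (Suc n)
      have "monom a (Suc n) = [:0, 1:] * monom a n" by (simp add: monom_Suc)
      hence "to_fract (monom a (Suc n)) = rat_var * to_fract (monom a n)"
        by (simp only: to_fract_mult rat_var_def)
      thus ?case by (simp add: Suc.IH mult_ac)
    qed
    have "rat_var ^ degree (pCons a p) * poly_at_rat (pCons a p) (inverse rat_var) =
          rat_const a * rat_var ^ Suc (degree p)
            + rat_var ^ degree p * poly_at_rat p (inverse rat_var)"
      using False by (simp add: poly_at_rat_pCons field_simps)
    also have "\<dots> = to_fract (monom a (Suc (degree p)) + reflect_poly p)"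
      by (simp add: mon pCons.IH)
    also have "monom a (Suc (degree p)) + reflect_poly p = reflect_poly (pCons a p)"
      using False by (simp add: reflect_poly_pCons' add.commute)
    finally show ?thesis .
  qed
qed simp

lemma poly_at_rat_inverse_var_eq_0_iff [simp]:
  "poly_at_rat p (inverse rat_var) = 0 \<longleftrightarrow> p = 0"
proof
  assume "poly_at_rat p (inverse rat_var) = 0"
  with poly_at_rat_inverse_var[of p] have "to_fract (reflect_poly p) = 0" by simp
  thus "p = 0" by simp
qed simp

lemma rat_recip_Fract:
  fixes p q :: "'a :: field poly"
  assumes "q \<noteq> 0"
  shows "rat_recip (Fract p q) =
           poly_at_rat p (inverse rat_var) / poly_at_rat q (inverse rat_var)"
  unfolding rat_recip_def
proof (rule the_equality)
  show "\<exists>p' q'. Fract p q = Fract p' q' \<and> q' \<noteq> 0 \<and>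
      poly_at_rat p (inverse rat_var) / poly_at_rat q (inverse rat_var) =
      poly_at_rat p' (inverse rat_var) / poly_at_rat q' (inverse rat_var)"
    using assms by blast
next
  fix s
  assume "\<exists>p' q'. Fract p q = Fract p' q' \<and> q' \<noteq> 0 \<and>
      s = poly_at_rat p' (inverse rat_var) / poly_at_rat q' (inverse rat_var)"
  then obtain p' q' where *: "Fract p q = Fract p' q'" "q' \<noteq> 0"
      "s = poly_at_rat p' (inverse rat_var) / poly_at_rat q' (inverse rat_var)"
    by blast
  from * assms have "p * q' = p' * q" by (simp add: eq_fract)
  hence "poly_at_rat p (inverse rat_var) * poly_at_rat q' (inverse rat_var) =
         poly_at_rat p' (inverse rat_var) * poly_at_rat q (inverse rat_var)"
    by (metis poly_at_rat_mult)
  with assms *(2,3)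
  show "s = poly_at_rat p (inverse rat_var) / poly_at_rat q (inverse rat_var)"
    by (simp add: frac_eq_eq)
qed

definition no_entry_pole_at :: "'a :: field poly fract mat \<Rightarrow> 'a \<Rightarrow> bool" where
  "no_entry_pole_at R x \<longleftrightarrow> (\<forall>i<dim_row R. \<forall>j<dim_col R. \<not> has_pole_at (R $$ (i,j)) x)"

definition rat_mat_eval :: "'a :: field poly fract mat \<Rightarrow> 'a \<Rightarrow> 'a mat" where
  "rat_mat_eval R x = map_mat (\<lambda>r. rat_eval r x) R"

definition mat_rank :: "'a :: field mat \<Rightarrow> nat" where
  "mat_rank A = vec_space.rank (dim_row A) A"

definition full_row_rank_in :: "'a :: field poly fract mat \<Rightarrow> 'a set \<Rightarrow> bool" where
  "full_row_rank_in R \<Omega> \<longleftrightarrow>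
     (\<forall>x\<in>\<Omega>. no_entry_pole_at R x \<and> mat_rank (rat_mat_eval R x) = dim_row R)"

definition full_row_normal_rank :: "'a :: field poly fract mat \<Rightarrow> bool" where
  "full_row_normal_rank R \<longleftrightarrow> mat_rank R = dim_row R"

definition regular_at :: "'a :: field poly fract mat \<Rightarrow> 'a \<Rightarrow> bool" where
  "regular_at R x \<longleftrightarrow>
     dim_row R = dim_col R \<and> no_entry_pole_at R x \<and> rat_eval (det R) x \<noteq> 0"

definition rev_mat :: "int \<Rightarrow> 'a :: field poly fract mat \<Rightarrow> 'a poly fract mat" where
  "rev_mat g R = map_mat (\<lambda>r. (rat_var powi g) * rat_recip r) R"

section \<open>Pencils and linearizations\<close>

abbreviation rat_mat :: "'a :: field poly mat \<Rightarrow> 'a poly fract mat" where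
  "rat_mat \<equiv> map_mat to_fract"

definition is_pencil :: "'a :: field poly mat \<Rightarrow> bool" where
  "is_pencil L \<longleftrightarrow> (\<forall>i<dim_row L. \<forall>j<dim_col L. degree (L $$ (i,j)) \<le> 1)"

text \<open>The \<open>insert 0\<close> only matters for matrices without entries.\<close>

definition poly_mat_degree :: "'a :: field poly mat \<Rightarrow> nat" where
  "poly_mat_degree L = Max (insert 0 {degree (L $$ (i,j)) | i j. i < dim_row L \<and> j < dim_col L})"

definition block_full_rank_pencil_one_col ::
    "'a :: field poly mat \<Rightarrow> 'a poly mat \<Rightarrow> 'a poly mat \<Rightarrow> bool" where
  "block_full_rank_pencil_one_col L M K \<longleftrightarrow>
     is_pencil L \<and> dim_col M = dim_col K \<and> L = M @\<^sub>r K \<and> full_row_normal_rank (rat_mat K)"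

definition dual_rational_basis ::
    "'a :: field poly fract mat \<Rightarrow> 'a poly fract mat \<Rightarrow> bool" where
  "dual_rational_basis K N \<longleftrightarrow>
     dim_row N + dim_row K = dim_col K \<and> dim_col N = dim_col K \<and> full_row_normal_rank N \<and>
     K * transpose_mat N = 0\<^sub>m (dim_row K) (dim_row N)"

definition associated_with_in ::
    "'a :: field poly mat \<Rightarrow> 'a poly mat \<Rightarrow> 'a poly fract mat \<Rightarrow> 'a set \<Rightarrow> bool" where
  "associated_with_in M K G \<Omega> \<longleftrightarrow>
     (\<exists>N N\<^sub>2. dual_rational_basis (rat_mat K) N \<and>
        N\<^sub>2 \<in> carrier_mat (dim_row M) (dim_row M) \<and> (\<forall>x\<in>\<Omega>. regular_at N\<^sub>2 x) \<and>
        full_row_rank_in (rat_mat K) \<Omega> \<and> full_row_rank_in N \<Omega> \<and>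
        G = N\<^sub>2 * rat_mat M * transpose_mat N)"

definition linearization_empty_state_in ::
    "'a :: field poly mat \<Rightarrow> 'a poly fract mat \<Rightarrow> 'a set \<Rightarrow> bool" where
  "linearization_empty_state_in L G \<Omega> \<longleftrightarrow>
     is_pencil L \<and>
     (\<forall>x\<in>\<Omega>. \<exists>(s\<^sub>1 :: nat) (s\<^sub>2 :: nat) R\<^sub>1 R\<^sub>2.
        int s\<^sub>1 - int s\<^sub>2 = int (dim_row L) - int (dim_row G) \<and>
        int s\<^sub>1 - int s\<^sub>2 = int (dim_col L) - int (dim_col G) \<and>
        R\<^sub>1 \<in> carrier_mat (dim_row G + s\<^sub>1) (dim_row G + s\<^sub>1) \<and>
        R\<^sub>2 \<in> carrier_mat (dim_col G + s\<^sub>1) (dim_col G + s\<^sub>1) \<and>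
        regular_at R\<^sub>1 x \<and> regular_at R\<^sub>2 x \<and>
        R\<^sub>1 * diag_block_mat [G, 1\<^sub>m s\<^sub>1] * R\<^sub>2 = diag_block_mat [rat_mat L, 1\<^sub>m s\<^sub>2])"

definition linearization_empty_state_at_infinity ::
    "'a :: field poly mat \<Rightarrow> 'a poly fract mat \<Rightarrow> int \<Rightarrow> bool" where
  "linearization_empty_state_at_infinity L G g \<longleftrightarrow>
     is_pencil L \<and>
     (\<exists>(s\<^sub>1 :: nat) (s\<^sub>2 :: nat) Q\<^sub>1 Q\<^sub>2.
        int s\<^sub>1 - int s\<^sub>2 = int (dim_row L) - int (dim_row G) \<and>
        int s\<^sub>1 - int s\<^sub>2 = int (dim_col L) - int (dim_col G) \<and>
        Q\<^sub>1 \<in> carrier_mat (dim_row G + s\<^sub>1) (dim_row G + s\<^sub>1) \<and>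
        Q\<^sub>2 \<in> carrier_mat (dim_col G + s\<^sub>1) (dim_col G + s\<^sub>1) \<and>
        regular_at Q\<^sub>1 0 \<and> regular_at Q\<^sub>2 0 \<and>
        Q\<^sub>1 * diag_block_mat [rev_mat g G, 1\<^sub>m s\<^sub>1] * Q\<^sub>2 =
          diag_block_mat [rev_mat (int (poly_mat_degree L)) (rat_mat L), 1\<^sub>m s\<^sub>2])"

section \<open>The rational matrix \<open>Q\<^sub>N\<close> and the pencil \<open>L\<^sub>N\<close>\<close>

text \<open>
  A pole is an element of \<open>'a option\<close>, with \<open>None\<close> for the point at infinity. The families are
  indexed as usual: poles \<open>\<xi> 1, \<dots>, \<xi> N\<close>, nodes \<open>\<sigma> 0, \<dots>, \<sigma> (N - 1)\<close>, scalars \<open>\<beta> 0, \<dots>, \<beta> N\<close> and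
  coefficient matrices \<open>D 0, \<dots>, D N\<close>; values at other indices are irrelevant.
\<close>

definition pole_recip :: "'a :: field option \<Rightarrow> 'a" where
  "pole_recip z = (case z of None \<Rightarrow> 0 | Some x \<Rightarrow> 1 / x)"

definition g_poly :: "(nat \<Rightarrow> 'a :: field) \<Rightarrow> (nat \<Rightarrow> 'a option) \<Rightarrow> nat \<Rightarrow> 'a poly" where
  "g_poly \<beta> \<xi> i = smult (\<beta> i) [:1, - pole_recip (\<xi> i):]"

definition h_poly :: "(nat \<Rightarrow> 'a :: field) \<Rightarrow> nat \<Rightarrow> 'a poly" where
  "h_poly \<sigma> j = [:- \<sigma> j, 1:]"

definition b_rat ::
    "(nat \<Rightarrow> 'a :: field) \<Rightarrow> (nat \<Rightarrow> 'a option) \<Rightarrow> (nat \<Rightarrow> 'a) \<Rightarrow> nat \<Rightarrow> 'a poly fract" where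
  "b_rat \<sigma> \<xi> \<beta> i =
     rat_const (1 / \<beta> 0) * (\<Prod>k=1..i. to_fract (h_poly \<sigma> (k - 1)) / to_fract (g_poly \<beta> \<xi> k))"

definition Q_mat ::
    "nat \<Rightarrow> nat \<Rightarrow> (nat \<Rightarrow> 'a :: field) \<Rightarrow> (nat \<Rightarrow> 'a option) \<Rightarrow> (nat \<Rightarrow> 'a) \<Rightarrow> (nat \<Rightarrow> 'a mat)
      \<Rightarrow> 'a poly fract mat" where
  "Q_mat m N \<sigma> \<xi> \<beta> D =
     mat m m (\<lambda>(r, c). \<Sum>i=0..N. b_rat \<sigma> \<xi> \<beta> i * rat_const (D i $$ (r, c)))"

text \<open>\<open>block_row m n B\<close> is the \<open>m \<times> nm\<close> matrix \<open>[B 0 \<dots> B (n - 1)]\<close> with \<open>m \<times> m\<close> blocks.\<close>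

definition block_row :: "nat \<Rightarrow> nat \<Rightarrow> (nat \<Rightarrow> 'a mat) \<Rightarrow> 'a mat" where
  "block_row m n B = mat m (n * m) (\<lambda>(r, c). B (c div m) $$ (r, c mod m))"

definition kronecker_mat :: "'a :: times mat \<Rightarrow> 'a mat \<Rightarrow> 'a mat" where
  "kronecker_mat A B = mat (dim_row A * dim_row B) (dim_col A * dim_col B)
     (\<lambda>(i, j). A $$ (i div dim_row B, j div dim_col B) * B $$ (i mod dim_row B, j mod dim_col B))"

definition M_mat ::
    "nat \<Rightarrow> nat \<Rightarrow> (nat \<Rightarrow> 'a :: field) \<Rightarrow> (nat \<Rightarrow> 'a option) \<Rightarrow> (nat \<Rightarrow> 'a) \<Rightarrow> (nat \<Rightarrow> 'a mat)
      \<Rightarrow> 'a poly mat" where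
  "M_mat m N \<sigma> \<xi> \<beta> D =
     (let gN = smult (1 / \<beta> N) (g_poly \<beta> \<xi> N);
          hN = smult (1 / \<beta> N) (h_poly \<sigma> (N - 1));
          C = (\<lambda>i. map_mat (\<lambda>d. [:d:]) (D i))
      in block_row m N (\<lambda>j. if j = N - 1 then gN \<cdot>\<^sub>m C (N - 1) + hN \<cdot>\<^sub>m C N else gN \<cdot>\<^sub>m C j))"

definition K_mat ::
    "nat \<Rightarrow> nat \<Rightarrow> (nat \<Rightarrow> 'a :: field) \<Rightarrow> (nat \<Rightarrow> 'a option) \<Rightarrow> (nat \<Rightarrow> 'a) \<Rightarrow> 'a poly mat" where
  "K_mat m N \<sigma> \<xi> \<beta> = kronecker_mat
     (mat (N - 1) N (\<lambda>(i, j). if j = i then - h_poly \<sigma> i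
                               else if j = i + 1 then g_poly \<beta> \<xi> (i + 1) else 0))
     (1\<^sub>m m)"

definition L_mat ::
    "nat \<Rightarrow> nat \<Rightarrow> (nat \<Rightarrow> 'a :: field) \<Rightarrow> (nat \<Rightarrow> 'a option) \<Rightarrow> (nat \<Rightarrow> 'a) \<Rightarrow> (nat \<Rightarrow> 'a mat)
      \<Rightarrow> 'a poly mat" where
  "L_mat m N \<sigma> \<xi> \<beta> D = M_mat m N \<sigma> \<xi> \<beta> D @\<^sub>r K_mat m N \<sigma> \<xi> \<beta>"

definition finite_poles :: "nat \<Rightarrow> (nat \<Rightarrow> 'a option) \<Rightarrow> 'a set" where
  "finite_poles N \<xi> = {x. \<exists>i\<in>{1..N}. \<xi> i = Some x}"

definition num_infinite_poles :: "nat \<Rightarrow> (nat \<Rightarrow> 'a option) \<Rightarrow> nat" where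
  "num_infinite_poles N \<xi> = card {i \<in> {1..N}. \<xi> i = None}"

end

theory Submission
  imports Defs
begin

text \<open>
  Put \<open>n\<^sub>j = c \<Prod>\<^bsub>k<j\<^esub> h\<^sub>k \<Prod>\<^bsub>j<k<N\<^esub> g\<^sub>k\<close>. The block column \<open>Nt = [n\<^sub>0 I; \<dots>; n\<^sub>N\<^sub>-\<^sub>1 I]\<close> satisfies \<open>K Nt = 0\<close>,
  and for a suitable rational function \<open>c\<close> also \<open>M Nt = Q\<close>. At a point that is not a pole all \<open>g\<^sub>k\<close>
  and \<open>c\<close> are units, hence so is \<open>n\<^sub>0\<close>. With \<open>E\<close> consisting of the last \<open>N - 1\<close> block columns of the
  identity, \<open>[Nt E]\<close> and the block triangular matrix \<open>K E\<close> are then regular there. This gives the full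
  rank statements, and \<open>[M; K] [Nt E] = [I, M E; 0, K E] diag(Q, I)\<close> is the required equivalence.
  After reversal, \<open>\<lambda> h\<^sub>j(1/\<lambda>) = 1 - \<sigma>\<^sub>j \<lambda>\<close> is a unit at \<open>0\<close>, and every infinite pole contributes one
  factor \<open>\<lambda>\<close> to \<open>\<Prod>\<^bsub>k\<^esub> \<lambda> g\<^sub>k(1/\<lambda>)\<close>, which is what the grade \<open>i\<^sub>N\<close> cancels; the same argument works at
  infinity with \<open>n\<^sub>N\<^sub>-\<^sub>1\<close> as the unit and the first \<open>N - 1\<close> block columns of the identity as \<open>E\<close>.
\<close>

section \<open>Values of rational functions\<close>

lemma no_pole_Fract: "poly q x \<noteq> 0 \<Longrightarrow> \<not> has_pole_at (Fract p q) x"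
  by (auto simp: has_pole_at_def)

lemma no_poleE:
  assumes "\<not> has_pole_at r x"
  obtains p q where "r = Fract p q" "poly q x \<noteq> 0" "q \<noteq> 0" "rat_eval r x = poly p x / poly q x"
  using assms by (metis has_pole_at_def poly_0 rat_eval_Fract)

lemma no_pole_to_fract [simp]: "\<not> has_pole_at (to_fract p) x"
  by (simp add: to_fract_def no_pole_Fract)

lemma rat_eval_to_fract [simp]: "rat_eval (to_fract p) x = poly p x"
  by (simp add: to_fract_def rat_eval_Fract)

lemma no_pole_const [simp]: "\<not> has_pole_at (rat_const c) x"
  and rat_eval_const [simp]: "rat_eval (rat_const c) x = c"
  by (simp_all add: rat_const_def)

lemma rat_const_1: "rat_const 1 = 1"
  by (simp add: rat_const_def one_pCons[symmetric])

lemma rat_const_inverse: "rat_const (1 / c) = 1 / rat_const c"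
proof (cases "c = 0")
  case False
  hence "rat_const c * rat_const (1 / c) = 1"
    by (simp add: rat_const_1 flip: rat_const_mult)
  thus ?thesis
    by (simp add: inverse_unique[symmetric] divide_inverse)
qed simp

lemma no_pole_0 [simp]: "\<not> has_pole_at 0 x" and rat_eval_0 [simp]: "rat_eval 0 x = 0"
  using no_pole_const[of 0 x] rat_eval_const[of 0 x] by (simp_all del: no_pole_const rat_eval_const)

lemma no_pole_1 [simp]: "\<not> has_pole_at 1 x" and rat_eval_1 [simp]: "rat_eval 1 x = 1"
  using no_pole_const[of 1 x] rat_eval_const[of 1 x]
  by (simp_all add: rat_const_1 del: no_pole_const rat_eval_const)

lemma
  assumes "\<not> has_pole_at r x" "\<not> has_pole_at s x"
  shows no_pole_add [simp]: "\<not> has_pole_at (r + s) x"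
    and rat_eval_add [simp]: "rat_eval (r + s) x = rat_eval r x + rat_eval s x"
    and no_pole_mult [simp]: "\<not> has_pole_at (r * s) x"
    and rat_eval_mult [simp]: "rat_eval (r * s) x = rat_eval r x * rat_eval s x"
proof -
  obtain p q where r: "r = Fract p q" "poly q x \<noteq> 0" "q \<noteq> 0" "rat_eval r x = poly p x / poly q x"
    using assms(1) by (rule no_poleE)
  obtain p' q' where s: "s = Fract p' q'" "poly q' x \<noteq> 0" "q' \<noteq> 0"
      "rat_eval s x = poly p' x / poly q' x"
    using assms(2) by (rule no_poleE)
  have add: "r + s = Fract (p * q' + p' * q) (q * q')" and mult: "r * s = Fract (p * p') (q * q')"
    using r s by simp_all
  have nz: "poly (q * q') x \<noteq> 0"
    using r s by simp
  show "\<not> has_pole_at (r + s) x" "\<not> has_pole_at (r * s) x"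
    unfolding add mult by (rule no_pole_Fract[OF nz])+
  show "rat_eval (r + s) x = rat_eval r x + rat_eval s x"
    "rat_eval (r * s) x = rat_eval r x * rat_eval s x"
    unfolding add mult rat_eval_Fract[OF nz] r(4) s(4) using r s by (simp_all add: field_simps)
qed

lemma
  assumes "\<not> has_pole_at r x"
  shows no_pole_uminus [simp]: "\<not> has_pole_at (- r) x"
    and rat_eval_uminus [simp]: "rat_eval (- r) x = - rat_eval r x"
proof -
  obtain p q where r: "r = Fract p q" "poly q x \<noteq> 0" "rat_eval r x = poly p x / poly q x"
    using assms by (rule no_poleE)
  have "- r = Fract (- p) q"
    using r by simp
  with r show "\<not> has_pole_at (- r) x" "rat_eval (- r) x = - rat_eval r x"
    by (auto simp: no_pole_Fract rat_eval_Fract simp del: minus_fract)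
qed

lemma no_pole_diff [simp]:
  "\<not> has_pole_at r x \<Longrightarrow> \<not> has_pole_at s x \<Longrightarrow> \<not> has_pole_at (r - s) x"
  by (metis no_pole_add no_pole_uminus uminus_add_conv_diff add.commute)

lemma
  assumes "\<And>i. i \<in> A \<Longrightarrow> \<not> has_pole_at (f i) x"
  shows no_pole_sum: "\<not> has_pole_at (sum f A) x"
    and rat_eval_sum: "rat_eval (sum f A) x = (\<Sum>i\<in>A. rat_eval (f i) x)"
proof -
  have "\<not> has_pole_at (sum f A) x \<and> rat_eval (sum f A) x = (\<Sum>i\<in>A. rat_eval (f i) x)"
    using assms by (induction A rule: infinite_finite_induct) auto
  thus "\<not> has_pole_at (sum f A) x" "rat_eval (sum f A) x = (\<Sum>i\<in>A. rat_eval (f i) x)"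
    by auto
qed

lemma
  assumes "\<And>i. i \<in> A \<Longrightarrow> \<not> has_pole_at (f i) x"
  shows no_pole_prod: "\<not> has_pole_at (prod f A) x"
    and rat_eval_prod: "rat_eval (prod f A) x = (\<Prod>i\<in>A. rat_eval (f i) x)"
proof -
  have "\<not> has_pole_at (prod f A) x \<and> rat_eval (prod f A) x = (\<Prod>i\<in>A. rat_eval (f i) x)"
    using assms by (induction A rule: infinite_finite_induct) auto
  thus "\<not> has_pole_at (prod f A) x" "rat_eval (prod f A) x = (\<Prod>i\<in>A. rat_eval (f i) x)"
    by auto
qed

text \<open>These are the units of the local ring of functions without a pole at \<open>x\<close>.
  At a pole \<open>rat_eval\<close> is an unspecified value, so absence of a pole is demanded along
  with a nonzero value.\<close>

definition unit_at :: "'a :: field poly fract \<Rightarrow> 'a \<Rightarrow> bool" where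
  "unit_at r x \<longleftrightarrow> \<not> has_pole_at r x \<and> rat_eval r x \<noteq> 0"

lemma unit_at_no_pole: "unit_at r x \<Longrightarrow> \<not> has_pole_at r x"
  by (simp add: unit_at_def)

lemma unit_at_nonzero: "unit_at r x \<Longrightarrow> r \<noteq> 0"
  by (auto simp: unit_at_def)

lemma unit_at_const: "c \<noteq> 0 \<Longrightarrow> unit_at (rat_const c) x"
  by (simp add: unit_at_def)

lemma unit_at_mult: "unit_at r x \<Longrightarrow> unit_at s x \<Longrightarrow> unit_at (r * s) x"
  by (simp add: unit_at_def)

lemma unit_at_prod: "(\<And>i. i \<in> A \<Longrightarrow> unit_at (f i) x) \<Longrightarrow> unit_at (prod f A) x"
  by (induction A rule: infinite_finite_induct) (auto simp: unit_at_def[of 1] intro: unit_at_mult)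

lemma unit_at_inverse:
  assumes "unit_at r x"
  shows "unit_at (inverse r) x"
proof -
  obtain p q where r: "r = Fract p q" "poly q x \<noteq> 0" "rat_eval r x = poly p x / poly q x"
    using assms by (auto simp: unit_at_def elim: no_poleE)
  hence "poly p x \<noteq> 0"
    using assms by (auto simp: unit_at_def)
  with r show ?thesis
    by (simp add: unit_at_def no_pole_Fract rat_eval_Fract)
qed

lemma no_pole_divide: "\<not> has_pole_at r x \<Longrightarrow> unit_at s x \<Longrightarrow> \<not> has_pole_at (r / s) x"
  unfolding divide_inverse by (meson no_pole_mult unit_at_inverse unit_at_no_pole)

section \<open>Values and regularity of rational matrices\<close>

lemma no_entry_pole_atI:
  "(\<And>i j. i < dim_row R \<Longrightarrow> j < dim_col R \<Longrightarrow> \<not> has_pole_at (R $$ (i, j)) x) \<Longrightarrow> no_entry_pole_at R x"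
  by (simp add: no_entry_pole_at_def)

lemma no_entry_pole_atD:
  "no_entry_pole_at R x \<Longrightarrow> i < dim_row R \<Longrightarrow> j < dim_col R \<Longrightarrow> \<not> has_pole_at (R $$ (i, j)) x"
  by (simp add: no_entry_pole_at_def)

lemma no_entry_pole_0 [simp]: "no_entry_pole_at (0\<^sub>m m n) x"
  by (simp add: no_entry_pole_at_def)

lemma no_entry_pole_1 [simp]: "no_entry_pole_at (1\<^sub>m n) x"
  by (simp add: no_entry_pole_at_def)

lemma no_entry_pole_rat_mat [simp]: "no_entry_pole_at (rat_mat A) x"
  by (simp add: no_entry_pole_at_def)

lemma no_entry_pole_transpose [simp]: "no_entry_pole_at (transpose_mat R) x \<longleftrightarrow> no_entry_pole_at R x"
  by (auto simp: no_entry_pole_at_def)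

lemma no_entry_pole_four_block:
  assumes "A \<in> carrier_mat r1 c1" "B \<in> carrier_mat r1 c2" "C \<in> carrier_mat r2 c1" "D \<in> carrier_mat r2 c2"
    and "no_entry_pole_at A x" "no_entry_pole_at B x" "no_entry_pole_at C x" "no_entry_pole_at D x"
  shows "no_entry_pole_at (four_block_mat A B C D) x"
  using assms by (auto intro!: no_entry_pole_atI simp: no_entry_pole_atD split: if_splits)

lemma no_entry_pole_mult:
  assumes "A \<in> carrier_mat r n" "B \<in> carrier_mat n c" "no_entry_pole_at A x" "no_entry_pole_at B x"
  shows "no_entry_pole_at (A * B) x"
  using assms
  by (intro no_entry_pole_atI)
     (auto simp: scalar_prod_def no_entry_pole_atD intro!: no_pole_sum no_pole_mult)

lemma rat_mat_eval_carrier [simp]: "A \<in> carrier_mat r c \<Longrightarrow> rat_mat_eval A x \<in> carrier_mat r c"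
  by (simp add: rat_mat_eval_def)

lemma rat_mat_eval_mult:
  assumes "A \<in> carrier_mat r n" "B \<in> carrier_mat n c" "no_entry_pole_at A x" "no_entry_pole_at B x"
  shows "rat_mat_eval (A * B) x = rat_mat_eval A x * rat_mat_eval B x"
  using assms
  by (intro eq_matI)
     (auto simp: rat_mat_eval_def scalar_prod_def no_entry_pole_atD intro!: trans[OF rat_eval_sum])

text \<open>Evaluation is known to respect sums and products only away from poles, so absence of
  poles is carried through every summand of the Leibniz formula.\<close>

lemma
  assumes A: "A \<in> carrier_mat n n" and np: "no_entry_pole_at A x"
  shows no_pole_det: "\<not> has_pole_at (det A) x"
    and det_rat_mat_eval: "det (rat_mat_eval A x) = rat_eval (det A) x"
proof -
  have entry: "\<not> has_pole_at (A $$ (i, p i)) x" if "p permutes {0..<n}" "i \<in> {0..<n}" for p i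
  proof -
    have "p i < n"
      using permutes_in_image[OF that(1), of i] that(2) by simp
    thus ?thesis
      using that(2) A by (intro no_entry_pole_atD[OF np]) auto
  qed
  \<comment> \<open>The sign is a rational function on one side and a field element on the other;
    being 1 or -1, it is preserved by evaluation.\<close>
  have sg: "\<not> has_pole_at (signof p) x" "rat_eval (signof p) x = signof p" for p :: "nat \<Rightarrow> nat"
    by (auto simp: sign_def)
  have summand: "\<not> has_pole_at (signof p * (\<Prod>i = 0..<n. A $$ (i, p i))) x" if "p permutes {0..<n}" for p
    by (intro no_pole_mult sg no_pole_prod entry[OF that])
  show "\<not> has_pole_at (det A) x"
    unfolding det_def'[OF A] using summand by (auto intro!: no_pole_sum)
  have "rat_eval (det A) x = (\<Sum>p | p permutes {0..<n}. rat_eval (signof p * (\<Prod>i = 0..<n. A $$ (i, p i))) x)"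
    unfolding det_def'[OF A] using summand by (auto intro!: rat_eval_sum)
  also have "\<dots> = (\<Sum>p | p permutes {0..<n}. signof p * (\<Prod>i = 0..<n. rat_mat_eval A x $$ (i, p i)))"
  proof (rule sum.cong[OF refl])
    fix p assume "p \<in> {p. p permutes {0..<n}}"
    hence p: "p permutes {0..<n}" by simp
    have "rat_eval (\<Prod>i = 0..<n. A $$ (i, p i)) x = (\<Prod>i = 0..<n. rat_eval (A $$ (i, p i)) x)"
      using entry[OF p] by (intro rat_eval_prod)
    also have "\<dots> = (\<Prod>i = 0..<n. rat_mat_eval A x $$ (i, p i))"
      using A permutes_in_image[OF p] by (intro prod.cong) (auto simp: rat_mat_eval_def)
    finally show "rat_eval (signof p * (\<Prod>i = 0..<n. A $$ (i, p i))) x =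
        signof p * (\<Prod>i = 0..<n. rat_mat_eval A x $$ (i, p i))"
      using entry[OF p] by (subst rat_eval_mult) (auto intro!: sg no_pole_prod simp: sg)
  qed
  also have "\<dots> = det (rat_mat_eval A x)"
    using A by (intro det_def'[symmetric]) simp
  finally show "det (rat_mat_eval A x) = rat_eval (det A) x" ..
qed

lemma regular_at_iff:
  "A \<in> carrier_mat n n \<Longrightarrow> regular_at A x \<longleftrightarrow> no_entry_pole_at A x \<and> unit_at (det A) x"
  using no_pole_det[of A n x] by (auto simp: regular_at_def unit_at_def)

text \<open>With both matrices free of poles, \<open>det A * det B = 1\<close> can be evaluated at
  \<open>x\<close>, which makes the value of \<open>det A\<close> nonzero. A pole-free inverse thus
  replaces the computation of a determinant.\<close>

lemma regular_at_inverse: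
  assumes A: "A \<in> carrier_mat n n" "no_entry_pole_at A x"
    and B: "B \<in> carrier_mat n n" "no_entry_pole_at B x" and "A * B = 1\<^sub>m n"
  shows "regular_at A x"
proof -
  have "det A * det B = 1"
    using assms det_mult[OF A(1) B(1)] by simp
  hence "rat_eval (det A) x * rat_eval (det B) x = 1"
    using no_pole_det[OF A] no_pole_det[OF B] by (simp flip: rat_eval_mult)
  thus ?thesis
    using A by (auto simp: regular_at_def)
qed

lemma regular_at_one [simp]: "regular_at (1\<^sub>m n) x"
  by (rule regular_at_inverse[where n = n and B = "1\<^sub>m n"]) auto

text \<open>If \<open>C\<close> inverts \<open>A * B\<close>, then \<open>B * C\<close> is a right
  inverse of \<open>A\<close>, so the columns of \<open>A\<close> span everything. The field is left
  arbitrary because this serves both rational matrices (normal rank) and their values (rank at a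
  point).\<close>

lemma mat_rank_full_row:
  fixes A B :: "'a :: field mat"
  assumes A: "A \<in> carrier_mat r c" and B: "B \<in> carrier_mat c r" and "det (A * B) \<noteq> 0"
  shows "mat_rank A = dim_row A"
proof -
  interpret vec_space "TYPE('a)" r .
  have AB: "A * B \<in> carrier_mat r r"
    using A B by simp
  obtain C where C: "C \<in> carrier_mat r r" "A * B * C = 1\<^sub>m r"
    using det_non_zero_imp_unit[OF AB assms(3), of "()"] AB
    by (auto simp: Units_def ring_mat_def)
  have "span (set (cols A)) = carrier_vec r"
  proof
    show "span (set (cols A)) \<subseteq> carrier_vec r"
      using col_space_eq[OF A] A by (auto simp: col_space_def)
    show "carrier_vec r \<subseteq> span (set (cols A))"
    proof
      fix v :: "'a vec" assume v: "v \<in> carrier_vec r"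
      have "A *\<^sub>v ((B * C) *\<^sub>v v) = (A * (B * C)) *\<^sub>v v"
        using A B C v by (intro assoc_mult_mat_vec[symmetric]) auto
      also have "A * (B * C) = 1\<^sub>m r"
        using assoc_mult_mat[OF A B C(1)] C(2) by simp
      finally have "A *\<^sub>v ((B * C) *\<^sub>v v) = v"
        using v by simp
      moreover have "(B * C) *\<^sub>v v \<in> carrier_vec c"
        using mult_carrier_mat[OF B C(1)] v by (rule mult_mat_vec_carrier)
      ultimately show "v \<in> span (set (cols A))"
        using col_space_eq[OF A] A v by (auto simp: col_space_def)
    qed
  qed
  hence "rank A = r"
    using dim_is_n by (simp add: rank_def module_vec_def)
  thus ?thesis
    using A by (simp add: mat_rank_def)
qed

text \<open>A nonzero value of the determinant at a single point already makes it a nonzero rational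
  function.\<close>

lemma full_row_normal_rankI:
  assumes "R \<in> carrier_mat r c" "X \<in> carrier_mat c r" "regular_at (R * X) x"
  shows "full_row_normal_rank R"
proof -
  have "det (R * X) \<noteq> 0"
    using assms(3) by (auto simp: regular_at_def)
  thus ?thesis
    using mat_rank_full_row[OF assms(1,2)] by (simp add: full_row_normal_rank_def)
qed

lemma mat_rank_rat_mat_eval:
  assumes R: "R \<in> carrier_mat r c" "no_entry_pole_at R x"
    and X: "X \<in> carrier_mat c r" "no_entry_pole_at X x" and "regular_at (R * X) x"
  shows "mat_rank (rat_mat_eval R x) = dim_row R"
proof -
  have "det (rat_mat_eval R x * rat_mat_eval X x) = rat_eval (det (R * X)) x"
    using assms no_entry_pole_mult[OF R(1) X(1) R(2) X(2)]
    by (simp add: rat_mat_eval_mult[symmetric] det_rat_mat_eval[of _ r])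
  hence "det (rat_mat_eval R x * rat_mat_eval X x) \<noteq> 0"
    using assms(5) by (simp add: regular_at_def)
  from mat_rank_full_row[OF _ _ this, of r c] R X show ?thesis
    by (simp add: rat_mat_eval_def)
qed

section \<open>Completing a matrix and its dual basis to regular matrices\<close>

text \<open>
  The matrices \<open>Y\<close> and \<open>Z\<close> form the inverse of the square matrix \<open>[Nt E]\<close>, which is therefore
  regular at \<open>x\<close>.
\<close>

definition dual_completion_at ::
    "nat \<Rightarrow> nat \<Rightarrow> 'a :: field poly fract mat \<Rightarrow> 'a poly fract mat \<Rightarrow> 'a \<Rightarrow> bool" where
  "dual_completion_at m s K Nt x \<longleftrightarrow>
     K \<in> carrier_mat s (m + s) \<and> no_entry_pole_at K x \<and>
     Nt \<in> carrier_mat (m + s) m \<and> no_entry_pole_at Nt x \<and> K * Nt = 0\<^sub>m s m \<and>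
     (\<exists>E Y Z. E \<in> carrier_mat (m + s) s \<and> no_entry_pole_at E x \<and>
        Y \<in> carrier_mat m (m + s) \<and> no_entry_pole_at Y x \<and>
        Z \<in> carrier_mat s (m + s) \<and> no_entry_pole_at Z x \<and>
        Y * Nt = 1\<^sub>m m \<and> Y * E = 0\<^sub>m m s \<and> Z * Nt = 0\<^sub>m s m \<and> Z * E = 1\<^sub>m s \<and>
        regular_at (K * E) x)"

text \<open>Both rank criteria need a right factor with regular product. For \<open>K\<close> it is
  \<open>E\<close>; for the dual basis it is the transpose of \<open>Y\<close>, by transposing
  \<open>Y * Nt = 1\<close>.\<close>

lemma dual_completion_full_rank:
  assumes "dual_completion_at m s K Nt x"
  shows "mat_rank (rat_mat_eval K x) = s" "full_row_normal_rank K"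
    "mat_rank (rat_mat_eval (transpose_mat Nt) x) = m" "full_row_normal_rank (transpose_mat Nt)"
proof -
  obtain E Y where K: "K \<in> carrier_mat s (m + s)" "no_entry_pole_at K x"
    and Nt: "Nt \<in> carrier_mat (m + s) m" "no_entry_pole_at Nt x"
    and E: "E \<in> carrier_mat (m + s) s" "no_entry_pole_at E x"
    and Y: "Y \<in> carrier_mat m (m + s)" "no_entry_pole_at Y x"
    and YN: "Y * Nt = 1\<^sub>m m" and KE: "regular_at (K * E) x"
    using assms unfolding dual_completion_at_def by blast
  show "mat_rank (rat_mat_eval K x) = s" "full_row_normal_rank K"
    using mat_rank_rat_mat_eval[OF K E KE] full_row_normal_rankI[OF K(1) E(1) KE] K by auto
  have tN: "transpose_mat Nt \<in> carrier_mat m (m + s)" and tY: "transpose_mat Y \<in> carrier_mat (m + s) m"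
    using Nt Y by auto
  have "transpose_mat Nt * transpose_mat Y = 1\<^sub>m m"
    using transpose_mult[OF Y(1) Nt(1)] YN by simp
  hence reg: "regular_at (transpose_mat Nt * transpose_mat Y) x"
    by simp
  show "mat_rank (rat_mat_eval (transpose_mat Nt) x) = m" "full_row_normal_rank (transpose_mat Nt)"
    using mat_rank_rat_mat_eval[OF tN _ tY _ reg] full_row_normal_rankI[OF tN tY reg] Nt Y by auto
qed

lemma diag_block_mat_two:
  "diag_block_mat [A, B] = four_block_mat A (0\<^sub>m (dim_row A) (dim_col B)) (0\<^sub>m (dim_row B) (dim_col A)) B"
  by (simp only: diag_block_mat.simps(2)[of A "[B]"] diag_block_mat_singleton Let_def)

lemma diag_block_mat_one_0: "diag_block_mat [A, 1\<^sub>m 0] = A"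
  unfolding diag_block_mat_two by (intro eq_matI) auto

lemma dual_completion_equivalence:
  assumes compl: "dual_completion_at m s K Nt x"
    and M: "M \<in> carrier_mat m (m + s)" "no_entry_pole_at M x"
  obtains R\<^sub>1 R\<^sub>2 where "R\<^sub>1 \<in> carrier_mat (m + s) (m + s)" "R\<^sub>2 \<in> carrier_mat (m + s) (m + s)"
    "regular_at R\<^sub>1 x" "regular_at R\<^sub>2 x" "R\<^sub>1 * diag_block_mat [M * Nt, 1\<^sub>m s] * R\<^sub>2 = M @\<^sub>r K"
proof -
  obtain E Y Z where K: "K \<in> carrier_mat s (m + s)" "no_entry_pole_at K x"
    and Nt: "Nt \<in> carrier_mat (m + s) m" "no_entry_pole_at Nt x" and KN: "K * Nt = 0\<^sub>m s m"
    and E: "E \<in> carrier_mat (m + s) s" "no_entry_pole_at E x"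
    and Y: "Y \<in> carrier_mat m (m + s)" "no_entry_pole_at Y x"
    and Z: "Z \<in> carrier_mat s (m + s)" "no_entry_pole_at Z x"
    and inv: "Y * Nt = 1\<^sub>m m" "Y * E = 0\<^sub>m m s" "Z * Nt = 0\<^sub>m s m" "Z * E = 1\<^sub>m s"
    and KE: "regular_at (K * E) x"
    using compl unfolding dual_completion_at_def by blast
  \<comment> \<open>Blocks with no rows or no columns let \<open>four_block_mat\<close> express
    \<open>[Nt E]\<close> and \<open>[Y; Z]\<close>, so that the block multiplication rule applies
    to them.\<close>
  define V where "V = four_block_mat Nt E (0\<^sub>m 0 m) (0\<^sub>m 0 s)"
  define R\<^sub>2 where "R\<^sub>2 = four_block_mat Y (0\<^sub>m m 0) Z (0\<^sub>m s 0)"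
  define R\<^sub>1 where "R\<^sub>1 = four_block_mat (1\<^sub>m m) (M * E) (0\<^sub>m s m) (K * E)"
  have V: "V \<in> carrier_mat (m + s) (m + s)" "no_entry_pole_at V x"
    using no_entry_pole_four_block[OF Nt(1) E(1) zero_carrier_mat zero_carrier_mat Nt(2) E(2)] Nt E
    by (auto simp: V_def)
  have R2: "R\<^sub>2 \<in> carrier_mat (m + s) (m + s)" "no_entry_pole_at R\<^sub>2 x"
    using no_entry_pole_four_block[OF Y(1) zero_carrier_mat Z(1) zero_carrier_mat Y(2) _ Z(2)] Y Z
    by (auto simp: R\<^sub>2_def)
  have ME: "M * E \<in> carrier_mat m s" "no_entry_pole_at (M * E) x"
    using M E no_entry_pole_mult[OF M(1) E(1) M(2) E(2)] by auto
  have KE': "K * E \<in> carrier_mat s s" "no_entry_pole_at (K * E) x"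
    using K E no_entry_pole_mult[OF K(1) E(1) K(2) E(2)] by auto
  have MN: "M * Nt \<in> carrier_mat m m"
    using M Nt by simp
  have R1: "R\<^sub>1 \<in> carrier_mat (m + s) (m + s)" "no_entry_pole_at R\<^sub>1 x"
    using ME KE' no_entry_pole_four_block[OF one_carrier_mat ME(1) zero_carrier_mat KE'(1) _ ME(2) _ KE'(2)]
    by (auto simp: R\<^sub>1_def)
  have "R\<^sub>2 * V = four_block_mat (1\<^sub>m m) (0\<^sub>m m s) (0\<^sub>m s m) (1\<^sub>m s)"
    unfolding R\<^sub>2_def V_def
    by (subst mult_four_block_mat[OF Y(1) _ Z(1) _ Nt(1) E(1)]) (auto simp: inv)
  hence R2V: "R\<^sub>2 * V = 1\<^sub>m (m + s)"
    by simp
  \<comment> \<open>For square matrices a one-sided inverse is two-sided; this order is the one that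
    cancels \<open>V\<close> at the end.\<close>
  have VR2: "V * R\<^sub>2 = 1\<^sub>m (m + s)"
    by (rule mat_mult_left_right_inverse[OF R2(1) V(1) R2V])
  \<comment> \<open>\<open>R\<^sub>1\<close> is block upper triangular with an identity in its
    corner, so its regularity reduces to that of \<open>K * E\<close>.\<close>
  have "det R\<^sub>1 = det (K * E)"
    using det_four_block_mat_lower_left_zero[OF one_carrier_mat ME(1) refl KE'(1)] by (simp add: R\<^sub>1_def)
  with R1 KE have regR1: "regular_at R\<^sub>1 x"
    by (simp add: regular_at_def)
  have regR2: "regular_at R\<^sub>2 x"
    by (rule regular_at_inverse[OF R2 V R2V])
  have L: "M @\<^sub>r K \<in> carrier_mat (m + s) (m + s)"
    using M K by auto
  have "(M @\<^sub>r K) * V = four_block_mat (M * Nt) (M * E) (0\<^sub>m s m) (K * E)"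
    using mult_four_block_mat[OF M(1) zero_carrier_mat[of m 0] K(1) zero_carrier_mat[of s 0]
        Nt(1) E(1) zero_carrier_mat[of 0 m] zero_carrier_mat[of 0 s]] M K MN ME(1) KE'(1)
    by (simp add: append_rows_def V_def KN)
  also have "\<dots> = R\<^sub>1 * diag_block_mat [M * Nt, 1\<^sub>m s]"
    using mult_four_block_mat[OF one_carrier_mat[of m] ME(1) zero_carrier_mat[of s m] KE'(1)
        MN zero_carrier_mat[of m s] zero_carrier_mat[of s m] one_carrier_mat[of s]]
      right_mult_zero_mat[OF ME(1)] right_mult_one_mat[OF ME(1)]
      right_mult_zero_mat[OF KE'(1)] right_mult_one_mat[OF KE'(1)] right_add_zero_mat[OF MN]
      left_add_zero_mat[OF ME(1)] left_add_zero_mat[OF KE'(1)] M Nt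
    by (simp add: diag_block_mat_two R\<^sub>1_def del: diag_block_mat.simps)
  finally have "R\<^sub>1 * diag_block_mat [M * Nt, 1\<^sub>m s] * R\<^sub>2 = (M @\<^sub>r K) * V * R\<^sub>2"
    by simp
  also have "\<dots> = M @\<^sub>r K"
    using assoc_mult_mat[OF L V(1) R2(1)] VR2 L by simp
  finally show ?thesis
    using that R1 R2 regR1 regR2 by blast
qed

section \<open>Kronecker products with an identity matrix\<close>

lemma kronecker_mat_carrier [simp]:
  "A \<in> carrier_mat r c \<Longrightarrow> kronecker_mat A (1\<^sub>m m) \<in> carrier_mat (r * m) (c * m)"
  by (auto simp: kronecker_mat_def)

lemma kronecker_one_index:
  fixes A :: "'a :: semiring_1 mat"
  assumes "A \<in> carrier_mat r c" "i < r * m" "j < c * m"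
  shows "kronecker_mat A (1\<^sub>m m) $$ (i, j) = (if i mod m = j mod m then A $$ (i div m, j div m) else 0)"
proof -
  have "m > 0"
    using assms(2) by (cases m) auto
  thus ?thesis
    using assms by (simp add: kronecker_mat_def)
qed

lemma sum_blocks: "(\<Sum>k<n * m. f k) = (\<Sum>j<n. \<Sum>b<m. f (j * m + b))" for f :: "nat \<Rightarrow> 'a :: comm_monoid_add"
proof -
  have "(\<Sum>k\<in>{j * m..<j * m + m}. f k) = (\<Sum>b<m. f (j * m + b))" for j
    using sum.shift_bounds_nat_ivl[of f 0 "j * m" m] by (simp add: lessThan_atLeast0 add.commute)
  thus ?thesis
    using sum.nat_group[of f m n] by simp
qed

lemma block_row_carrier [simp]: "block_row m n B \<in> carrier_mat m (n * m)"
  by (simp add: block_row_def)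

lemma block_row_index:
  "i < m \<Longrightarrow> j < n * m \<Longrightarrow> block_row m n B $$ (i, j) = B (j div m) $$ (i, j mod m)"
  by (simp add: block_row_def)

text \<open>Write \<open>k = j * m + b\<close>. Within block \<open>j\<close> the identity factor
  keeps only \<open>b = c mod m\<close>, so the inner sum collapses. The weight \<open>f\<close>
  depends on both \<open>j\<close> and \<open>b\<close>, which covers block rows as well as
  Kronecker products on the left.\<close>

lemma sum_kronecker_column:
  fixes f :: "nat \<Rightarrow> nat \<Rightarrow> 'a :: semiring_1"
  assumes A: "A \<in> carrier_mat n q" and c: "c < q * m"
  shows "(\<Sum>k<n * m. f (k div m) (k mod m) * kronecker_mat A (1\<^sub>m m) $$ (k, c)) =
         (\<Sum>j<n. f j (c mod m) * A $$ (j, c div m))"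
proof -
  have m: "m > 0"
    using c by (cases m) auto
  have "j * m + b < n * m" if "j < n" "b < m" for j b
  proof -
    have "j * m + b < (j + 1) * m" using that by simp
    also have "\<dots> \<le> n * m" using that by (intro mult_right_mono) auto
    finally show ?thesis .
  qed
  hence "(\<Sum>k<n * m. f (k div m) (k mod m) * kronecker_mat A (1\<^sub>m m) $$ (k, c)) =
      (\<Sum>j<n. \<Sum>b<m. f j b * (if b = c mod m then A $$ (j, c div m) else 0))"
    unfolding sum_blocks using m by (intro sum.cong refl) (simp add: kronecker_one_index[OF A _ c])
  also have "\<dots> = (\<Sum>j<n. f j (c mod m) * A $$ (j, c div m))"
    using m by (intro sum.cong refl) (simp add: if_distrib[of "\<lambda>t. f _ _ * t"] sum.delta cong: if_cong)
  finally show ?thesis .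
qed

text \<open>The left factor has arbitrary blocks and need not be a Kronecker product, so
  \<open>M Nt\<close> needs this rule besides the mixed product rule.\<close>

lemma block_row_mult_kronecker_one:
  fixes v :: "'a :: semiring_1 mat"
  assumes v: "v \<in> carrier_mat n q"
  shows "block_row m n B * kronecker_mat v (1\<^sub>m m) =
         mat m (q * m) (\<lambda>(r, c). \<Sum>j<n. B j $$ (r, c mod m) * v $$ (j, c div m))"
    (is "?L = ?R")
proof (rule eq_matI)
  have kv: "kronecker_mat v (1\<^sub>m m) \<in> carrier_mat (n * m) (q * m)"
    using v by simp
  show "dim_row ?L = dim_row ?R" "dim_col ?L = dim_col ?R"
    using kv by (auto simp: block_row_def)
  fix r c assume "r < dim_row ?R" "c < dim_col ?R"
  hence rc: "r < m" "c < q * m" by auto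
  have "?L $$ (r, c) = (\<Sum>k<n * m. B (k div m) $$ (r, k mod m) * kronecker_mat v (1\<^sub>m m) $$ (k, c))"
    using rc kv carrier_matD[OF kv]
    by (simp add: block_row_def scalar_prod_def lessThan_atLeast0)
  thus "?L $$ (r, c) = ?R $$ (r, c)"
    using rc sum_kronecker_column[OF v rc(2), of "\<lambda>j b. B j $$ (r, b)"] by simp
qed

lemma kronecker_one_mult:
  fixes A B :: "'a :: semiring_1 mat"
  assumes A: "A \<in> carrier_mat n q" and B: "B \<in> carrier_mat q r"
  shows "kronecker_mat A (1\<^sub>m m) * kronecker_mat B (1\<^sub>m m) = kronecker_mat (A * B) (1\<^sub>m m)"
    (is "?L = ?R")
proof (rule eq_matI)
  have kA: "kronecker_mat A (1\<^sub>m m) \<in> carrier_mat (n * m) (q * m)"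
    and kB: "kronecker_mat B (1\<^sub>m m) \<in> carrier_mat (q * m) (r * m)"
    and kAB: "?R \<in> carrier_mat (n * m) (r * m)"
    using A B by simp_all
  show "dim_row ?L = dim_row ?R" "dim_col ?L = dim_col ?R"
    using kA kB kAB by auto
  fix i c assume "i < dim_row ?R" "c < dim_col ?R"
  hence ic: "i < n * m" "c < r * m" using kAB by auto
  have "m > 0" using ic by (cases m) auto
  with ic have id: "i div m < n" "c div m < r" by (simp_all add: less_mult_imp_div_less)
  have "?L $$ (i, c) = (\<Sum>k<q * m. kronecker_mat A (1\<^sub>m m) $$ (i, k) * kronecker_mat B (1\<^sub>m m) $$ (k, c))"
    using ic kA kB carrier_matD[OF kA] carrier_matD[OF kB]
    by (simp add: scalar_prod_def lessThan_atLeast0)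
  also have "\<dots> = (\<Sum>k<q * m. (if i mod m = k mod m then A $$ (i div m, k div m) else 0) *
      kronecker_mat B (1\<^sub>m m) $$ (k, c))"
    by (intro sum.cong refl) (simp add: kronecker_one_index[OF A ic(1)])
  also have "\<dots> = (\<Sum>j<q. (if i mod m = c mod m then A $$ (i div m, j) else 0) * B $$ (j, c div m))"
    by (rule sum_kronecker_column[OF B ic(2), of "\<lambda>j b. if i mod m = b then A $$ (i div m, j) else 0"])
  also have "\<dots> = ?R $$ (i, c)"
    using ic id A B
    by (simp add: kronecker_one_index[OF mult_carrier_mat[OF A B]] scalar_prod_def lessThan_atLeast0)
  finally show "?L $$ (i, c) = ?R $$ (i, c)" .
qed

lemma kronecker_one_one: "kronecker_mat (1\<^sub>m n) (1\<^sub>m m) = (1\<^sub>m (n * m) :: 'a :: semiring_1 mat)"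
proof (rule eq_matI)
  fix i j assume "i < dim_row (1\<^sub>m (n * m) :: 'a mat)" "j < dim_col (1\<^sub>m (n * m) :: 'a mat)"
  hence ij: "i < n * m" "j < n * m" by auto
  have "i div m < n" "j div m < n"
    using ij by (simp_all add: less_mult_imp_div_less)
  moreover have "i mod m = j mod m \<and> i div m = j div m \<longleftrightarrow> i = j"
    by (metis div_mult_mod_eq)
  ultimately show "kronecker_mat (1\<^sub>m n) (1\<^sub>m m) $$ (i, j) = (1\<^sub>m (n * m) :: 'a mat) $$ (i, j)"
    using ij by (auto simp: kronecker_one_index[OF one_carrier_mat ij])
qed (auto simp: kronecker_mat_def)

lemma kronecker_zero_one: "kronecker_mat (0\<^sub>m r c) (1\<^sub>m m) = (0\<^sub>m (r * m) (c * m) :: 'a :: semiring_1 mat)"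
  by (rule eq_matI) (auto simp: kronecker_one_index[OF zero_carrier_mat] less_mult_imp_div_less kronecker_mat_def)

lemma no_entry_pole_kronecker_one:
  assumes A: "A \<in> carrier_mat r c" and np: "no_entry_pole_at A x"
  shows "no_entry_pole_at (kronecker_mat A (1\<^sub>m m)) x"
proof (rule no_entry_pole_atI)
  fix i j assume "i < dim_row (kronecker_mat A (1\<^sub>m m))" "j < dim_col (kronecker_mat A (1\<^sub>m m))"
  hence ij: "i < r * m" "j < c * m" using kronecker_mat_carrier[OF A, of m] by auto
  thus "\<not> has_pole_at (kronecker_mat A (1\<^sub>m m) $$ (i, j)) x"
    using A np by (simp add: kronecker_one_index[OF A ij] no_entry_pole_atD less_mult_imp_div_less)
qed

lemma regular_at_lower_triangular:
  assumes A: "A \<in> carrier_mat n n" "no_entry_pole_at A x"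
    and "\<And>i j. i < j \<Longrightarrow> j < n \<Longrightarrow> A $$ (i, j) = 0" and "\<And>i. i < n \<Longrightarrow> unit_at (A $$ (i, i)) x"
  shows "regular_at A x"
proof -
  have "det A = (\<Prod>i = 0..<n. A $$ (i, i))"
    using det_lower_triangular[OF assms(3) A(1)] A by (simp add: prod_list_diag_prod)
  thus ?thesis
    using unit_at_prod[of "{0..<n}" "\<lambda>i. A $$ (i, i)" x] assms(4)
    by (simp add: regular_at_iff[OF A(1)] A(2))
qed

lemma regular_at_kronecker_lower_triangular:
  assumes A: "A \<in> carrier_mat n n" "no_entry_pole_at A x"
    and zero: "\<And>i j. i < j \<Longrightarrow> j < n \<Longrightarrow> A $$ (i, j) = 0"
    and unit: "\<And>i. i < n \<Longrightarrow> unit_at (A $$ (i, i)) x"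
  shows "regular_at (kronecker_mat A (1\<^sub>m m)) x"
proof (rule regular_at_lower_triangular)
  show "kronecker_mat A (1\<^sub>m m) \<in> carrier_mat (n * m) (n * m)" "no_entry_pole_at (kronecker_mat A (1\<^sub>m m)) x"
    using A by (auto intro: no_entry_pole_kronecker_one)
next
  fix i j assume ij: "i < j" "j < n * m"
  \<comment> \<open>Below, \<open>i < j\<close> with equal residues forces the block index to
    increase strictly; with different residues the identity factor gives 0. Either way triangularity
    passes to the Kronecker product.\<close>
  have "i div m \<le> j div m"
    using ij by (intro div_le_mono) simp
  moreover have "i div m \<noteq> j div m" if "i mod m = j mod m"
    using ij that by (metis div_mult_mod_eq less_irrefl)
  moreover have "j div m < n"
    using ij by (simp add: less_mult_imp_div_less)
  ultimately show "kronecker_mat A (1\<^sub>m m) $$ (i, j) = 0"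
    using ij by (auto simp: kronecker_one_index[OF A(1)] intro!: zero)
next
  fix i assume "i < n * m"
  thus "unit_at (kronecker_mat A (1\<^sub>m m) $$ (i, i)) x"
    by (simp add: kronecker_one_index[OF A(1)] unit less_mult_imp_div_less)
qed

lemma transpose_kronecker_one:
  fixes A :: "'a :: semiring_1 mat"
  assumes A: "A \<in> carrier_mat r c"
  shows "transpose_mat (kronecker_mat A (1\<^sub>m m)) = kronecker_mat (transpose_mat A) (1\<^sub>m m)"
proof (rule eq_matI)
  have tA: "transpose_mat A \<in> carrier_mat c r"
    using A by simp
  fix i j assume "i < dim_row (kronecker_mat (transpose_mat A) (1\<^sub>m m))"
    "j < dim_col (kronecker_mat (transpose_mat A) (1\<^sub>m m))"
  hence ij: "i < c * m" "j < r * m"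
    using kronecker_mat_carrier[OF tA, of m] by auto
  have "transpose_mat (kronecker_mat A (1\<^sub>m m)) $$ (i, j) = kronecker_mat A (1\<^sub>m m) $$ (j, i)"
    using ij kronecker_mat_carrier[OF A, of m] by (intro index_transpose_mat(1)) auto
  also have "\<dots> = (if j mod m = i mod m then A $$ (j div m, i div m) else 0)"
    by (rule kronecker_one_index[OF A ij(2,1)])
  also have "\<dots> = (if i mod m = j mod m then transpose_mat A $$ (i div m, j div m) else 0)"
    using A ij less_mult_imp_div_less[of i c m] less_mult_imp_div_less[of j r m] by (cases "i mod m = j mod m") simp_all
  also have "\<dots> = kronecker_mat (transpose_mat A) (1\<^sub>m m) $$ (i, j)"
    by (rule kronecker_one_index[OF tA ij, symmetric])
  finally show "transpose_mat (kronecker_mat A (1\<^sub>m m)) $$ (i, j) = kronecker_mat (transpose_mat A) (1\<^sub>m m) $$ (i, j)" .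
qed (auto simp: kronecker_mat_def)

lemma regular_at_transpose:
  assumes "A \<in> carrier_mat n n"
  shows "regular_at (transpose_mat A) x \<longleftrightarrow> regular_at A x"
  using assms by (simp add: regular_at_def det_transpose) 

text \<open>Transposition preserves regularity and commutes with the Kronecker product with an
  identity, which reduces this to the lower triangular case.\<close>

lemma regular_at_kronecker_upper_triangular:
  assumes A: "A \<in> carrier_mat n n" "no_entry_pole_at A x"
    and "\<And>i j. i < j \<Longrightarrow> j < n \<Longrightarrow> A $$ (j, i) = 0" and "\<And>i. i < n \<Longrightarrow> unit_at (A $$ (i, i)) x"
  shows "regular_at (kronecker_mat A (1\<^sub>m m)) x"
proof -
  have "regular_at (kronecker_mat (transpose_mat A) (1\<^sub>m m)) x"
    by (rule regular_at_kronecker_lower_triangular[where n = n]) (use assms in auto)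
  thus ?thesis
    unfolding transpose_kronecker_one[OF A(1), symmetric] regular_at_transpose[OF kronecker_mat_carrier[OF A(1)]] .
qed

section \<open>Bidiagonal matrices\<close>

text \<open>The scalar matrix behind \<open>K_mat\<close>. Over a general ring with free \<gamma>
  and \<eta>, it covers the polynomial pencil, its image in the rational functions, and its
  reversal.\<close>

definition bidiagonal_mat :: "nat \<Rightarrow> (nat \<Rightarrow> 'a :: ring_1) \<Rightarrow> (nat \<Rightarrow> 'a) \<Rightarrow> 'a mat" where
  "bidiagonal_mat N \<gamma> \<eta> =
     mat (N - 1) N (\<lambda>(i, j). if j = i then - \<eta> i else if j = i + 1 then \<gamma> (i + 1) else 0)"

definition column_mat :: "nat \<Rightarrow> (nat \<Rightarrow> 'a) \<Rightarrow> 'a mat" where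
  "column_mat N n = mat N 1 (\<lambda>(j, _). n j)"

text \<open>The increasing enumeration of the indices other than \<open>p\<close>.\<close>

definition skip :: "nat \<Rightarrow> nat \<Rightarrow> nat" where
  "skip p i = (if i < p then i else i + 1)"

lemma skip_neq: "skip p i \<noteq> p" "p \<noteq> skip p i"
  by (auto simp: skip_def)

lemma skip_inj [simp]: "skip p i = skip p j \<longleftrightarrow> i = j"
  by (auto simp: skip_def)

lemma skip_less: "p < N \<Longrightarrow> i < N - 1 \<Longrightarrow> skip p i < N"
  by (auto simp: skip_def)

lemma sum_single_mult:
  fixes f :: "nat \<Rightarrow> 'a :: semiring_1"
  assumes "a < n"
  shows "(\<Sum>j = 0..<n. (if j = a then c else 0) * f j) = c * f a"
    and "(\<Sum>j = 0..<n. f j * (if j = a then c else 0)) = f a * c"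
proof -
  have "(\<Sum>j = 0..<n. (if j = a then c else 0) * f j) = (\<Sum>j = 0..<n. if j = a then c * f j else 0)"
    "(\<Sum>j = 0..<n. f j * (if j = a then c else 0)) = (\<Sum>j = 0..<n. if j = a then f j * c else 0)"
    by (intro sum.cong; simp)+
  with assms show "(\<Sum>j = 0..<n. (if j = a then c else 0) * f j) = c * f a"
    "(\<Sum>j = 0..<n. f j * (if j = a then c else 0)) = f a * c"
    by (simp_all add: sum.delta)
qed

text \<open>The index \<open>p\<close> is a pivot: \<open>n p\<close> is invertible, and deleting
  column \<open>p\<close> of the bidiagonal matrix leaves a triangular one. The two alternatives in
  \<open>pivot\<close> serve the finite points and the point at infinity, respectively.\<close>

lemma dual_completion_bidiagonal:
  fixes \<gamma> \<eta> n :: "nat \<Rightarrow> 'a :: field poly fract"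
  assumes p: "p < N"
    and rec: "\<And>i. i < N - 1 \<Longrightarrow> \<gamma> (i + 1) * n (i + 1) = \<eta> i * n i"
    and np_n: "\<And>j. j < N \<Longrightarrow> \<not> has_pole_at (n j) x" and unit_n: "unit_at (n p) x"
    and np_\<gamma>: "\<And>k. k \<in> {1..<N} \<Longrightarrow> \<not> has_pole_at (\<gamma> k) x"
    and np_\<eta>: "\<And>k. k < N - 1 \<Longrightarrow> \<not> has_pole_at (\<eta> k) x"
    and pivot: "p = 0 \<and> (\<forall>k\<in>{1..<N}. unit_at (\<gamma> k) x) \<or> p = N - 1 \<and> (\<forall>k<N - 1. unit_at (\<eta> k) x)"
  shows "dual_completion_at m ((N - 1) * m)
    (kronecker_mat (bidiagonal_mat N \<gamma> \<eta>) (1\<^sub>m m)) (kronecker_mat (column_mat N n) (1\<^sub>m m)) x"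
proof -
  define K where "K = bidiagonal_mat N \<gamma> \<eta>"
  define V where "V = column_mat N n"
  \<comment> \<open>\<open>E\<close> has the unit columns other than the \<open>p\<close>-th.
    \<open>Y\<close> and \<open>Z\<close> invert \<open>[V E]\<close> by elimination:
    \<open>Y\<close> divides coordinate \<open>p\<close> by \<open>n p\<close>, and \<open>Z\<close>
    reads the other coordinates after subtracting that multiple of \<open>V\<close>.\<close>
  define E where "E = mat N (N - 1) (\<lambda>(j, i). if j = skip p i then 1 else 0 :: 'a poly fract)"
  define Y where "Y = mat 1 N (\<lambda>(i :: nat, j). if j = p then inverse (n p) else 0)"
  define Z where "Z = mat (N - 1) N
    (\<lambda>(i, j). (if j = skip p i then 1 else 0) - (if j = p then n (skip p i) * inverse (n p) else 0))"
  note np_p = np_n[OF p]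
  have np_inv: "\<not> has_pole_at (inverse (n p)) x" and n0: "n p \<noteq> 0"
    using unit_at_no_pole[OF unit_at_inverse[OF unit_n]] unit_at_nonzero[OF unit_n] by simp_all
  have K: "K \<in> carrier_mat (N - 1) N" "no_entry_pole_at K x"
    using np_\<gamma> np_\<eta> by (auto simp: K_def bidiagonal_mat_def no_entry_pole_at_def)
  have V: "V \<in> carrier_mat N 1" "no_entry_pole_at V x"
    using np_n by (auto simp: V_def column_mat_def no_entry_pole_at_def)
  have E: "E \<in> carrier_mat N (N - 1)" "no_entry_pole_at E x"
    by (auto simp: E_def no_entry_pole_at_def)
  have Y: "Y \<in> carrier_mat 1 N" "no_entry_pole_at Y x"
    using np_inv by (auto simp: Y_def no_entry_pole_at_def)
  have Z: "Z \<in> carrier_mat (N - 1) N" "no_entry_pole_at Z x"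
    using np_inv np_n skip_less[OF p] by (auto simp: Z_def no_entry_pole_at_def)
  have KV: "K * V = 0\<^sub>m (N - 1) 1"
  proof (rule eq_matI)
    fix i j assume "i < dim_row (0\<^sub>m (N - 1) 1 :: 'a poly fract mat)" "j < dim_col (0\<^sub>m (N - 1) 1 :: 'a poly fract mat)"
    hence i: "i < N - 1" "i < N" "i + 1 < N" "j = 0" by auto
    have "(K * V) $$ (i, j) =
        (\<Sum>l = 0..<N. (if l = i then - \<eta> i else if l = i + 1 then \<gamma> (i + 1) else 0) * n l)"
      using i by (simp add: K_def bidiagonal_mat_def V_def column_mat_def scalar_prod_def)
    also have "\<dots> = (\<Sum>l = 0..<N. (if l = i then - \<eta> i else 0) * n l + (if l = i + 1 then \<gamma> (i + 1) else 0) * n l)"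
      by (intro sum.cong) auto
    also have "\<dots> = - \<eta> i * n i + \<gamma> (i + 1) * n (i + 1)"
      unfolding sum.distrib sum_single_mult(1)[OF i(2)] sum_single_mult(1)[OF i(3)] ..
    finally show "(K * V) $$ (i, j) = 0\<^sub>m (N - 1) 1 $$ (i, j)"
      using i rec[OF i(1)] by simp
  qed (use K V in auto)
  have YV: "Y * V = 1\<^sub>m 1"
    using p n0 by (intro eq_matI) (auto simp: Y_def V_def column_mat_def scalar_prod_def sum_single_mult)
  have YE: "Y * E = 0\<^sub>m 1 (N - 1)"
    using p by (intro eq_matI) (auto simp: Y_def E_def scalar_prod_def sum_single_mult skip_neq)
  have ZV: "Z * V = 0\<^sub>m (N - 1) 1"
    using p n0 skip_less[OF p]
    by (intro eq_matI)
       (auto simp: Z_def V_def column_mat_def scalar_prod_def left_diff_distrib sum_subtractf sum_single_mult)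
  have ZE: "Z * E = 1\<^sub>m (N - 1)"
    using p n0 skip_less[OF p]
    by (intro eq_matI)
       (auto simp: Z_def E_def scalar_prod_def left_diff_distrib sum_subtractf sum_single_mult skip_neq)
  have KE_index: "(K * E) $$ (i, j) = K $$ (i, skip p j)" if "i < N - 1" "j < N - 1" for i j
    using that K skip_less[OF p, of j] by (simp add: E_def scalar_prod_def sum_single_mult)
  have KE: "K * E \<in> carrier_mat (N - 1) (N - 1)" "no_entry_pole_at (K * E) x"
    using K E no_entry_pole_mult[OF K(1) E(1) K(2) E(2)] by auto
  have K_index: "K $$ (i, j) = (if j = i then - \<eta> i else if j = i + 1 then \<gamma> (i + 1) else 0)"
    if "i < N - 1" "j < N" for i j
    using that by (simp add: K_def bidiagonal_mat_def)
  \<comment> \<open>\<open>K * E\<close> is \<open>K\<close> without column \<open>p\<close>. For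
    \<open>p = 0\<close> the diagonal consists of the \<gamma> with the negated \<eta> below it; for
    \<open>p = N - 1\<close> the diagonal consists of the negated \<eta> with the \<gamma> above
    it.\<close>
  have "regular_at (kronecker_mat (K * E) (1\<^sub>m m)) x"
    using pivot
  proof
    assume *: "p = 0 \<and> (\<forall>k\<in>{1..<N}. unit_at (\<gamma> k) x)"
    show ?thesis
    proof (rule regular_at_kronecker_lower_triangular[OF KE])
      show "(K * E) $$ (i, j) = 0" if "i < j" "j < N - 1" for i j
        using that * by (simp add: KE_index K_index skip_def)
      show "unit_at ((K * E) $$ (i, i)) x" if "i < N - 1" for i
        using that * by (simp add: KE_index K_index skip_def)
    qed
  next
    assume *: "p = N - 1 \<and> (\<forall>k<N - 1. unit_at (\<eta> k) x)"
    show ?thesis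
    proof (rule regular_at_kronecker_upper_triangular[OF KE])
      show "(K * E) $$ (j, i) = 0" if "i < j" "j < N - 1" for i j
        using that * by (simp add: KE_index K_index skip_def)
      show "unit_at ((K * E) $$ (i, i)) x" if "i < N - 1" for i
        using that * by (simp add: KE_index K_index skip_def unit_at_def)
    qed
  qed
  hence reg: "regular_at (kronecker_mat K (1\<^sub>m m) * kronecker_mat E (1\<^sub>m m)) x"
    by (simp add: kronecker_one_mult[OF K(1) E(1)])
  have Nm: "m + (N - 1) * m = N * m"
    using p by (cases N) auto
  note carrier = kronecker_mat_carrier[of _ _ _ m]
  have car: "kronecker_mat K (1\<^sub>m m) \<in> carrier_mat ((N - 1) * m) (N * m)"
    "kronecker_mat V (1\<^sub>m m) \<in> carrier_mat (N * m) m"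
    "kronecker_mat E (1\<^sub>m m) \<in> carrier_mat (N * m) ((N - 1) * m)"
    "kronecker_mat Y (1\<^sub>m m) \<in> carrier_mat m (N * m)"
    "kronecker_mat Z (1\<^sub>m m) \<in> carrier_mat ((N - 1) * m) (N * m)"
    using carrier[OF K(1)] carrier[OF V(1)] carrier[OF E(1)] carrier[OF Y(1)] carrier[OF Z(1)] by simp_all
  \<comment> \<open>Everything has been shown for scalar matrices; the mixed product rule lifts each
    identity to \<open>m\<close> by \<open>m\<close> blocks, and \<open>Nm\<close> adjusts the
    sizes.\<close>
  show ?thesis
    unfolding dual_completion_at_def Nm K_def[symmetric] V_def[symmetric]
  proof (intro conjI exI)
    show "kronecker_mat K (1\<^sub>m m) * kronecker_mat V (1\<^sub>m m) = 0\<^sub>m ((N - 1) * m) m"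
      unfolding kronecker_one_mult[OF K(1) V(1)] KV kronecker_zero_one by simp
    show "kronecker_mat Y (1\<^sub>m m) * kronecker_mat V (1\<^sub>m m) = 1\<^sub>m m"
      unfolding kronecker_one_mult[OF Y(1) V(1)] YV kronecker_one_one by simp
    show "kronecker_mat Y (1\<^sub>m m) * kronecker_mat E (1\<^sub>m m) = 0\<^sub>m m ((N - 1) * m)"
      unfolding kronecker_one_mult[OF Y(1) E(1)] YE kronecker_zero_one by simp
    show "kronecker_mat Z (1\<^sub>m m) * kronecker_mat V (1\<^sub>m m) = 0\<^sub>m ((N - 1) * m) m"
      unfolding kronecker_one_mult[OF Z(1) V(1)] ZV kronecker_zero_one by simp
    show "kronecker_mat Z (1\<^sub>m m) * kronecker_mat E (1\<^sub>m m) = 1\<^sub>m ((N - 1) * m)"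
      unfolding kronecker_one_mult[OF Z(1) E(1)] ZE kronecker_one_one ..
  qed (use car reg K V E Y Z no_entry_pole_kronecker_one in blast)+
qed

text \<open>With the constant \<open>c\<close> used for the finite points this is \<beta>_N b_j /
  g_N. Keeping all divisions inside \<open>c\<close> makes poles visible and gives reversal the same
  shape.\<close>

definition dual_coeff :: "nat \<Rightarrow> (nat \<Rightarrow> 'a :: comm_ring_1) \<Rightarrow> (nat \<Rightarrow> 'a) \<Rightarrow> 'a \<Rightarrow> nat \<Rightarrow> 'a" where
  "dual_coeff N \<gamma> \<eta> c j = c * (\<Prod>k<j. \<eta> k) * (\<Prod>k\<in>{j<..<N}. \<gamma> k)"

text \<open>One row of \<open>K Nt = 0\<close>: passing from \<open>i\<close> to
  \<open>i + 1\<close> trades the factor \<open>\<gamma> (i + 1)\<close> for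
  \<open>\<eta> i\<close>.\<close>

lemma dual_coeff_rec:
  assumes "i < N - 1"
  shows "\<gamma> (i + 1) * dual_coeff N \<gamma> \<eta> c (i + 1) = \<eta> i * dual_coeff N \<gamma> \<eta> c i"
proof -
  have "{i<..<N} = insert (i + 1) {i + 1<..<N}"
    using assms by auto
  thus ?thesis
    by (simp add: dual_coeff_def mult_ac)
qed

lemma no_pole_dual_coeff:
  fixes \<gamma> \<eta> :: "nat \<Rightarrow> 'a :: field poly fract"
  assumes "\<not> has_pole_at c x" "\<And>k. k < N \<Longrightarrow> \<not> has_pole_at (\<eta> k) x" "\<And>k. k < N \<Longrightarrow> \<not> has_pole_at (\<gamma> k) x"
    and "j < N"
  shows "\<not> has_pole_at (dual_coeff N \<gamma> \<eta> c j) x"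
  unfolding dual_coeff_def using assms by (intro no_pole_mult no_pole_prod) auto

text \<open>\<open>M_mat\<close> with g, h and \<beta>_N replaced by parameters, so that one
  computation covers the pencil and its reversal.\<close>

definition first_block_row ::
    "nat \<Rightarrow> nat \<Rightarrow> (nat \<Rightarrow> 'a :: field) \<Rightarrow> (nat \<Rightarrow> 'a) \<Rightarrow> 'a \<Rightarrow> (nat \<Rightarrow> 'a mat) \<Rightarrow> 'a mat" where
  "first_block_row m N \<gamma> \<eta> b D = block_row m N
     (\<lambda>j. if j = N - 1 then (\<gamma> N / b) \<cdot>\<^sub>m D (N - 1) + (\<eta> (N - 1) / b) \<cdot>\<^sub>m D N else (\<gamma> N / b) \<cdot>\<^sub>m D j)"

text \<open>Q_N over a common denominator: \<open>v\<close> stands for 1 / \<beta>_0 divided by the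
  product of all \<open>\<gamma> k\<close>, times a power of the variable after reversal.\<close>

definition basis_combination ::
    "nat \<Rightarrow> nat \<Rightarrow> (nat \<Rightarrow> 'a :: field) \<Rightarrow> (nat \<Rightarrow> 'a) \<Rightarrow> 'a \<Rightarrow> (nat \<Rightarrow> 'a mat) \<Rightarrow> 'a mat" where
  "basis_combination m N \<gamma> \<eta> v D =
     mat m m (\<lambda>(r, c). \<Sum>j = 0..N. v * (\<Prod>k<j. \<eta> k) * (\<Prod>k\<in>{j<..N}. \<gamma> k) * D j $$ (r, c))"

lemma first_block_row_carrier [simp]: "first_block_row m N \<gamma> \<eta> b D \<in> carrier_mat m (N * m)"
  by (simp add: first_block_row_def)

lemma first_block_row_index:
  assumes "r < m" "c < N * m" "\<forall>i\<in>{0..N}. D i \<in> carrier_mat m m"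
  shows "first_block_row m N \<gamma> \<eta> b D $$ (r, c) = \<gamma> N / b * D (c div m) $$ (r, c mod m) +
    (if c div m = N - 1 then \<eta> (N - 1) / b * D N $$ (r, c mod m) else 0)"
proof -
  have cd: "c div m < N" "c mod m < m"
    using assms by (auto simp: less_mult_imp_div_less)
  have D: "D (c div m) \<in> carrier_mat m m" "D N \<in> carrier_mat m m"
    using assms(3) cd by auto
  have "first_block_row m N \<gamma> \<eta> b D $$ (r, c) =
      (if c div m = N - 1 then (\<gamma> N / b) \<cdot>\<^sub>m D (c div m) + (\<eta> (N - 1) / b) \<cdot>\<^sub>m D N
       else (\<gamma> N / b) \<cdot>\<^sub>m D (c div m)) $$ (r, c mod m)"
    unfolding first_block_row_def block_row_index[OF assms(1,2)] by (intro if_cong arg_cong2[of _ _ _ _ "($$)"]) simp_all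
  thus ?thesis
    using assms(1) cd D by (cases "c div m = N - 1") simp_all
qed

text \<open>The factor \<open>\<gamma> N / b\<close> completes the product in
  \<open>dual_coeff\<close> to \<open>{j<..N}\<close> and cancels \<open>b\<close>. The extra \<eta>
  term in the last block supplies the summand with index \<open>N\<close>.\<close>

lemma first_block_row_mult_dual:
  assumes N: "N > 0" and b: "b \<noteq> 0" and D: "\<forall>i\<in>{0..N}. D i \<in> carrier_mat m m"
  shows "first_block_row m N \<gamma> \<eta> b D * kronecker_mat (column_mat N (dual_coeff N \<gamma> \<eta> (b * v))) (1\<^sub>m m) =
    basis_combination m N \<gamma> \<eta> v D" (is "?L = ?R")
proof (rule eq_matI)
  let ?n = "dual_coeff N \<gamma> \<eta> (b * v)"
  have V: "column_mat N ?n \<in> carrier_mat N 1"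
    by (simp add: column_mat_def)
  show "dim_row ?L = dim_row ?R" "dim_col ?L = dim_col ?R"
    using kronecker_mat_carrier[OF V, of m] carrier_matD[OF first_block_row_carrier]
    by (simp_all add: basis_combination_def)
  fix r c assume "r < dim_row ?R" "c < dim_col ?R"
  hence rc: "r < m" "c < m" by (auto simp: basis_combination_def)
  define d where "d = (\<lambda>j. D j $$ (r, c))"
  have split: "{j<..N} = insert N {j<..<N}" if "j < N" for j
    using that by auto
  have "?L $$ (r, c) = (\<Sum>j<N. (if j = N - 1 then (\<gamma> N / b) \<cdot>\<^sub>m D (N - 1) + (\<eta> (N - 1) / b) \<cdot>\<^sub>m D N
      else (\<gamma> N / b) \<cdot>\<^sub>m D j) $$ (r, c) * ?n j)"
    unfolding first_block_row_def block_row_mult_kronecker_one[OF V] using rc by (simp add: column_mat_def)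
  also have "\<dots> = (\<Sum>j<N. \<gamma> N / b * d j * ?n j + (if j = N - 1 then \<eta> (N - 1) / b * d N else 0) * ?n j)"
  proof (rule sum.cong[OF refl])
    fix j assume "j \<in> {..<N}"
    hence "D j \<in> carrier_mat m m" "D N \<in> carrier_mat m m"
      using D by auto
    thus "(if j = N - 1 then (\<gamma> N / b) \<cdot>\<^sub>m D (N - 1) + (\<eta> (N - 1) / b) \<cdot>\<^sub>m D N
      else (\<gamma> N / b) \<cdot>\<^sub>m D j) $$ (r, c) * ?n j =
      \<gamma> N / b * d j * ?n j + (if j = N - 1 then \<eta> (N - 1) / b * d N else 0) * ?n j"
      using rc by (auto simp: d_def algebra_simps)
  qed
  also have "\<dots> = (\<Sum>j<N. \<gamma> N / b * d j * ?n j) + \<eta> (N - 1) / b * d N * ?n (N - 1)"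
    using N sum_single_mult(1)[of "N - 1" N _ ?n] by (simp add: sum.distrib lessThan_atLeast0)
  also have "(\<Sum>j<N. \<gamma> N / b * d j * ?n j) =
      (\<Sum>j<N. v * (\<Prod>k<j. \<eta> k) * (\<Prod>k\<in>{j<..N}. \<gamma> k) * d j)"
    using b by (intro sum.cong refl) (simp add: dual_coeff_def split)
  also have "\<eta> (N - 1) / b * d N * ?n (N - 1) = v * (\<Prod>k<N. \<eta> k) * (\<Prod>k\<in>{N<..N}. \<gamma> k) * d N"
  proof -
    have "{N - 1<..<N} = {}" by auto
    moreover have "(\<Prod>k<N. \<eta> k) = (\<Prod>k<N - 1. \<eta> k) * \<eta> (N - 1)"
      using N by (cases N) auto
    ultimately show ?thesis
      using b by (simp add: dual_coeff_def)
  qed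
  also have "(\<Sum>j<N. v * (\<Prod>k<j. \<eta> k) * (\<Prod>k\<in>{j<..N}. \<gamma> k) * d j) +
      v * (\<Prod>k<N. \<eta> k) * (\<Prod>k\<in>{N<..N}. \<gamma> k) * d N =
      (\<Sum>j = 0..N. v * (\<Prod>k<j. \<eta> k) * (\<Prod>k\<in>{j<..N}. \<gamma> k) * d j)"
    by (simp add: atLeast0AtMost lessThan_Suc_atMost[symmetric])
  finally show "?L $$ (r, c) = ?R $$ (r, c)"
    using rc by (simp add: basis_combination_def d_def)
qed

section \<open>Reversal\<close>

lemma rat_recip_to_fract: "rat_recip (to_fract p) = poly_at_rat p (inverse rat_var)"
proof -
  have "poly_at_rat 1 s = (1 :: 'a poly fract)" for s
    using poly_at_rat_pCons[of 1 0 s] by (simp add: rat_const_1 one_pCons)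
  thus ?thesis
    by (simp add: to_fract_def rat_recip_Fract)
qed

lemma rat_recip_const [simp]: "rat_recip (rat_const c) = rat_const c"
  by (simp add: rat_const_def[of c] rat_recip_to_fract poly_at_rat_pCons)

lemma rat_recip_0 [simp]: "rat_recip 0 = 0"
  using rat_recip_const[of 0] by (simp del: rat_recip_const)

lemma rat_recip_1 [simp]: "rat_recip 1 = 1"
  using rat_recip_const[of 1] by (simp add: rat_const_1 del: rat_recip_const)

lemma rat_recip_add: "rat_recip (r + s) = rat_recip r + rat_recip s"
  and rat_recip_mult: "rat_recip (r * s) = rat_recip r * rat_recip s"
proof -
  obtain p q p' q' where r: "r = Fract p q" "q \<noteq> 0" and s: "s = Fract p' q'" "q' \<noteq> 0"
    by (metis Fract_cases)
  have "rat_recip (Fract (p * q' + p' * q) (q * q')) = rat_recip r + rat_recip s"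
    using r s by (simp add: rat_recip_Fract poly_at_rat_add poly_at_rat_mult add_frac_eq del: add_fract)
  thus "rat_recip (r + s) = rat_recip r + rat_recip s"
    using r s by simp
  have "rat_recip (Fract (p * p') (q * q')) = rat_recip r * rat_recip s"
    using r s by (simp add: rat_recip_Fract poly_at_rat_mult)
  thus "rat_recip (r * s) = rat_recip r * rat_recip s"
    using r s by simp
qed

lemma rat_recip_uminus: "rat_recip (- r) = - rat_recip r"
  using rat_recip_add[of r "- r"] by (simp add: eq_neg_iff_add_eq_0 add.commute)

lemma rat_recip_inverse: "rat_recip (inverse r) = inverse (rat_recip r)"
proof (cases "r = 0")
  case False
  hence "rat_recip r * rat_recip (inverse r) = 1"
    by (simp flip: rat_recip_mult)
  thus ?thesis
    by (rule inverse_unique[symmetric])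
qed simp

lemma rat_recip_divide: "rat_recip (r / s) = rat_recip r / rat_recip s"
  by (simp add: divide_inverse rat_recip_mult rat_recip_inverse)

lemma rat_recip_sum: "rat_recip (sum f A) = (\<Sum>i\<in>A. rat_recip (f i))"
  by (induction A rule: infinite_finite_induct) (simp_all add: rat_recip_add)

lemma rat_recip_prod: "rat_recip (prod f A) = (\<Prod>i\<in>A. rat_recip (f i))"
  by (induction A rule: infinite_finite_induct) (simp_all add: rat_recip_mult)

text \<open>Reversal of grade 1, the degree of the pencil when \<open>m > 0\<close>, as a map on
  single entries.\<close>

definition rev1 :: "'a :: field poly fract \<Rightarrow> 'a poly fract" where
  "rev1 r = rat_var * rat_recip r"

lemma rev1_0 [simp]: "rev1 0 = 0"
  by (simp add: rev1_def)

lemma rev1_uminus: "rev1 (- r) = - rev1 r"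
  by (simp add: rev1_def rat_recip_uminus)

lemma rev1_linear: "rev1 (to_fract [:a, b:]) = to_fract [:b, a:]"
proof -
  have "rat_var * (rat_const a + inverse rat_var * rat_const b) = rat_const b + rat_var * rat_const a"
    by (simp add: field_simps)
  also have "\<dots> = to_fract ([:b:] + [:0, 1:] * [:a:])"
    by (simp only: rat_const_def rat_var_def to_fract_add to_fract_mult)
  finally show ?thesis
    by (simp add: rev1_def rat_recip_to_fract poly_at_rat_pCons)
qed

lemma rev_mat_1: "rev_mat 1 R = map_mat rev1 R"
  by (simp add: rev_mat_def rev1_def[abs_def])

section \<open>Entrywise maps of the pencil\<close>

text \<open>Only 0 and negation have to be respected, since the entries are 0, \<gamma> or negated
  \<eta>. This admits \<open>rev1\<close>, which is not multiplicative, besides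
  \<open>to_fract\<close>.\<close>

lemma map_kronecker_bidiagonal:
  fixes f :: "'a :: ring_1 \<Rightarrow> 'b :: ring_1"
  assumes "f 0 = 0" "\<And>a. f (- a) = - f a"
  shows "map_mat f (kronecker_mat (bidiagonal_mat N \<gamma> \<eta>) (1\<^sub>m m)) =
    kronecker_mat (bidiagonal_mat N (\<lambda>k. f (\<gamma> k)) (\<lambda>k. f (\<eta> k))) (1\<^sub>m m)"
proof (rule eq_matI)
  let ?B = "bidiagonal_mat N \<gamma> \<eta>" and ?B' = "bidiagonal_mat N (\<lambda>k. f (\<gamma> k)) (\<lambda>k. f (\<eta> k))"
  have B: "?B \<in> carrier_mat (N - 1) N" "?B' \<in> carrier_mat (N - 1) N"
    by (simp_all add: bidiagonal_mat_def)
  show "dim_row (map_mat f (kronecker_mat ?B (1\<^sub>m m))) = dim_row (kronecker_mat ?B' (1\<^sub>m m))"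
    "dim_col (map_mat f (kronecker_mat ?B (1\<^sub>m m))) = dim_col (kronecker_mat ?B' (1\<^sub>m m))"
    using kronecker_mat_carrier[OF B(1), of m] kronecker_mat_carrier[OF B(2), of m] by auto
  fix i j assume "i < dim_row (kronecker_mat ?B' (1\<^sub>m m))" "j < dim_col (kronecker_mat ?B' (1\<^sub>m m))"
  hence ij: "i < (N - 1) * m" "j < N * m"
    using kronecker_mat_carrier[OF B(2), of m] by auto
  have "i div m < N - 1" "j div m < N"
    using ij by (simp_all add: less_mult_imp_div_less)
  hence "f (?B $$ (i div m, j div m)) = ?B' $$ (i div m, j div m)"
    using assms by (simp add: bidiagonal_mat_def)
  thus "map_mat f (kronecker_mat ?B (1\<^sub>m m)) $$ (i, j) = kronecker_mat ?B' (1\<^sub>m m) $$ (i, j)"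
    using ij kronecker_mat_carrier[OF B(1), of m] assms(1)
    by (simp add: kronecker_one_index[OF B(1) ij] kronecker_one_index[OF B(2) ij])
qed

lemma map_append_rows:
  assumes "A \<in> carrier_mat r1 c" "B \<in> carrier_mat r2 c"
  shows "map_mat f (A @\<^sub>r B) = map_mat f A @\<^sub>r map_mat f B"
  using assms by (intro eq_matI) (auto simp: append_rows_def)

lemma K_mat_eq: "K_mat m N \<sigma> \<xi> \<beta> = kronecker_mat (bidiagonal_mat N (g_poly \<beta> \<xi>) (h_poly \<sigma>)) (1\<^sub>m m)"
  by (simp add: K_mat_def bidiagonal_mat_def)

lemma K_mat_carrier: "K_mat m N \<sigma> \<xi> \<beta> \<in> carrier_mat ((N - 1) * m) (N * m)"
  unfolding K_mat_eq by (rule kronecker_mat_carrier) (simp add: bidiagonal_mat_def)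

lemma K_mat_index:
  assumes "i < (N - 1) * m" "j < N * m"
  shows "K_mat m N \<sigma> \<xi> \<beta> $$ (i, j) = (if i mod m \<noteq> j mod m then 0
    else if j div m = i div m then - h_poly \<sigma> (i div m)
    else if j div m = i div m + 1 then g_poly \<beta> \<xi> (i div m + 1) else 0)"
proof -
  have "bidiagonal_mat N (g_poly \<beta> \<xi>) (h_poly \<sigma>) \<in> carrier_mat (N - 1) N"
    by (simp add: bidiagonal_mat_def)
  from kronecker_one_index[OF this assms] show ?thesis
    using assms unfolding K_mat_eq by (simp add: bidiagonal_mat_def less_mult_imp_div_less)
qed

lemma M_mat_carrier: "M_mat m N \<sigma> \<xi> \<beta> D \<in> carrier_mat m (N * m)"
  by (simp add: M_mat_def Let_def)

lemma M_mat_index: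
  assumes rc: "r < m" "c < N * m" and D: "\<forall>i\<in>{0..N}. D i \<in> carrier_mat m m"
  shows "M_mat m N \<sigma> \<xi> \<beta> D $$ (r, c) =
    smult (1 / \<beta> N * D (c div m) $$ (r, c mod m)) (g_poly \<beta> \<xi> N) +
    (if c div m = N - 1 then smult (1 / \<beta> N * D N $$ (r, c mod m)) (h_poly \<sigma> (N - 1)) else 0)"
proof -
  have cd: "c div m < N" "c mod m < m"
    using rc by (auto simp: less_mult_imp_div_less)
  have D': "D (c div m) \<in> carrier_mat m m" "D N \<in> carrier_mat m m"
    using D cd by auto
  show ?thesis
    using rc cd D'
    by (cases "c div m = N - 1")
       (simp_all add: M_mat_def Let_def block_row_index mult.commute[of _ "[:_:]"] mult.commute[of "1 / \<beta> N"])
qed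

lemma rat_M_mat:
  assumes D: "\<forall>i\<in>{0..N}. D i \<in> carrier_mat m m"
  shows "rat_mat (M_mat m N \<sigma> \<xi> \<beta> D) =
    first_block_row m N (\<lambda>k. to_fract (g_poly \<beta> \<xi> k)) (\<lambda>k. to_fract (h_poly \<sigma> k)) (rat_const (\<beta> N))
      (\<lambda>i. map_mat rat_const (D i))" (is "_ = ?R")
proof (rule eq_matI)
  have D': "\<forall>i\<in>{0..N}. map_mat rat_const (D i) \<in> carrier_mat m m"
    using D by simp
  show "dim_row (rat_mat (M_mat m N \<sigma> \<xi> \<beta> D)) = dim_row ?R" "dim_col (rat_mat (M_mat m N \<sigma> \<xi> \<beta> D)) = dim_col ?R"
    by (simp_all add: carrier_matD[OF first_block_row_carrier] carrier_matD[OF M_mat_carrier])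
  fix r c assume "r < dim_row ?R" "c < dim_col ?R"
  hence rc: "r < m" "c < N * m" by (simp_all add: carrier_matD[OF first_block_row_carrier])
  have cd: "c div m < N" "c mod m < m"
    using rc by (auto simp: less_mult_imp_div_less)
  have Dc: "D (c div m) \<in> carrier_mat m m" "D N \<in> carrier_mat m m"
    using D cd by auto
  have smult: "to_fract (smult (d / \<beta> N) p) = to_fract p / rat_const (\<beta> N) * rat_const d" for d p
  proof -
    have "smult (d / \<beta> N) p = [:1 / \<beta> N:] * [:d:] * p"
      by simp
    hence "to_fract (smult (d / \<beta> N) p) = rat_const (1 / \<beta> N) * rat_const d * to_fract p"
      by (simp only: to_fract_mult rat_const_def)
    also have "rat_const (1 / \<beta> N) = 1 / rat_const (\<beta> N)"
      by (rule rat_const_inverse)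
    finally show ?thesis by simp
  qed
  show "rat_mat (M_mat m N \<sigma> \<xi> \<beta> D) $$ (r, c) = ?R $$ (r, c)"
    unfolding first_block_row_index[OF rc D']
    using rc cd Dc M_mat_carrier[of m N \<sigma> \<xi> \<beta> D] by (simp add: M_mat_index[OF rc D] smult)
qed

text \<open>Each entry is a linear expression in \<gamma> and \<eta> with constant coefficients.
  Constants are fixed by \<open>rat_recip\<close>, so the single factor \<open>rat_var\<close> is
  absorbed by \<gamma> and \<eta>.\<close>

lemma rev1_first_block_row:
  assumes D: "\<forall>i\<in>{0..N}. D i \<in> carrier_mat m m"
  shows "map_mat rev1 (first_block_row m N \<gamma> \<eta> (rat_const b) (\<lambda>i. map_mat rat_const (D i))) =
    first_block_row m N (\<lambda>k. rev1 (\<gamma> k)) (\<lambda>k. rev1 (\<eta> k)) (rat_const b) (\<lambda>i. map_mat rat_const (D i))"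
    (is "map_mat rev1 ?L = ?R")
proof (rule eq_matI)
  have D': "\<forall>i\<in>{0..N}. map_mat rat_const (D i) \<in> carrier_mat m m"
    using D by simp
  show "dim_row (map_mat rev1 ?L) = dim_row ?R" "dim_col (map_mat rev1 ?L) = dim_col ?R"
    by (simp_all add: carrier_matD[OF first_block_row_carrier])
  fix r c assume "r < dim_row ?R" "c < dim_col ?R"
  hence rc: "r < m" "c < N * m" by (simp_all add: carrier_matD[OF first_block_row_carrier])
  have cd: "c div m < N" "c mod m < m"
    using rc by (auto simp: less_mult_imp_div_less)
  have Dc: "D (c div m) \<in> carrier_mat m m" "D N \<in> carrier_mat m m"
    using D cd by auto
  have "map_mat rev1 ?L $$ (r, c) = rev1 (?L $$ (r, c))"
    using rc by (simp add: carrier_matD[OF first_block_row_carrier])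
  also have "\<dots> = ?R $$ (r, c)"
    unfolding first_block_row_index[OF rc D'] using rc cd Dc
    by (simp add: rev1_def rat_recip_add rat_recip_mult rat_recip_divide algebra_simps)
  finally show "map_mat rev1 ?L $$ (r, c) = ?R $$ (r, c)" .
qed

section \<open>The basis functions\<close>

text \<open>Expanding by the \<gamma> factors of index above \<open>j\<close> brings all basis
  functions to one common denominator, as \<open>basis_combination\<close> requires.\<close>

lemma scaled_basis_function:
  fixes \<gamma> \<eta> :: "nat \<Rightarrow> 'a :: field"
  assumes "j \<le> N" and "\<And>k. k \<in> {1..N} \<Longrightarrow> \<gamma> k \<noteq> 0"
  shows "(\<Prod>k = 1..j. \<eta> (k - 1) / \<gamma> k) = inverse (\<Prod>k = 1..N. \<gamma> k) * (\<Prod>k<j. \<eta> k) * (\<Prod>k\<in>{j<..N}. \<gamma> k)"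
proof -
  have "{1..N} = {1..j} \<union> {j<..N}"
    using assms(1) by auto
  hence "(\<Prod>k = 1..N. \<gamma> k) = (\<Prod>k = 1..j. \<gamma> k) * (\<Prod>k\<in>{j<..N}. \<gamma> k)"
    by (simp add: prod.union_disjoint disjoint_iff)
  moreover have "(\<Prod>k\<in>{j<..N}. \<gamma> k) \<noteq> 0"
    using assms by auto
  moreover have "(\<Prod>k = 1..j. \<eta> (k - 1)) = (\<Prod>k<j. \<eta> k)"
    by (rule prod.reindex_bij_witness[of _ Suc "\<lambda>k. k - 1"]) auto
  ultimately show ?thesis
    by (simp add: prod_dividef field_simps)
qed

lemma rev1_divide: "rev1 r / rev1 s = rat_recip (r / s)"
  by (simp add: rev1_def rat_recip_divide)

lemma Q_mat_eq:
  assumes D: "\<forall>i\<in>{0..N}. D i \<in> carrier_mat m m"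
    and g: "\<forall>k\<in>{1..N}. g_poly \<beta> \<xi> k \<noteq> 0"
  shows "Q_mat m N \<sigma> \<xi> \<beta> D = basis_combination m N (\<lambda>k. to_fract (g_poly \<beta> \<xi> k)) (\<lambda>k. to_fract (h_poly \<sigma> k))
     (rat_const (1 / \<beta> 0) * inverse (\<Prod>k = 1..N. to_fract (g_poly \<beta> \<xi> k))) (\<lambda>i. map_mat rat_const (D i))"
  unfolding Q_mat_def basis_combination_def
proof (rule cong_mat[OF refl refl], clarify, rule sum.cong[OF refl])
  fix r c j assume "r < m" "c < m" and j: "j \<in> {0..N}"
  thus "b_rat \<sigma> \<xi> \<beta> j * rat_const (D j $$ (r, c)) =
    rat_const (1 / \<beta> 0) * inverse (\<Prod>k = 1..N. to_fract (g_poly \<beta> \<xi> k)) * (\<Prod>k<j. to_fract (h_poly \<sigma> k)) *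
    (\<Prod>k\<in>{j<..N}. to_fract (g_poly \<beta> \<xi> k)) * map_mat rat_const (D j) $$ (r, c)"
    using bspec[OF D j] g
      scaled_basis_function[of j N "\<lambda>k. to_fract (g_poly \<beta> \<xi> k)" "\<lambda>k. to_fract (h_poly \<sigma> k)"]
    by (simp add: b_rat_def mult.assoc)
qed

text \<open>Each b_j has as many h factors as g factors, so the variables introduced by reversing
  them with grade 1 cancel. The grade of Q_N survives as the one factor
  \<open>rat_var ^ e\<close>.\<close>

lemma rev_Q_mat_eq:
  assumes D: "\<forall>i\<in>{0..N}. D i \<in> carrier_mat m m"
    and g: "\<forall>k\<in>{1..N}. rev1 (to_fract (g_poly \<beta> \<xi> k)) \<noteq> 0"
  shows "rev_mat (int e) (Q_mat m N \<sigma> \<xi> \<beta> D) =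
    basis_combination m N (\<lambda>k. rev1 (to_fract (g_poly \<beta> \<xi> k))) (\<lambda>k. rev1 (to_fract (h_poly \<sigma> k)))
     (rat_var ^ e * (rat_const (1 / \<beta> 0) * inverse (\<Prod>k = 1..N. rev1 (to_fract (g_poly \<beta> \<xi> k)))))
     (\<lambda>i. map_mat rat_const (D i))" (is "?L = ?R")
proof (rule eq_matI)
  show "dim_row ?L = dim_row ?R" "dim_col ?L = dim_col ?R"
    by (auto simp: rev_mat_def Q_mat_def basis_combination_def)
  fix r c assume "r < dim_row ?R" "c < dim_col ?R"
  hence rc: "r < m" "c < m" by (auto simp: basis_combination_def)
  have "?L $$ (r, c) = (\<Sum>j = 0..N. rat_var ^ e * (rat_recip (b_rat \<sigma> \<xi> \<beta> j) * rat_const (D j $$ (r, c))))"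
    using rc by (simp add: rev_mat_def Q_mat_def power_int_of_nat rat_recip_sum rat_recip_mult sum_distrib_left)
  also have "\<dots> = ?R $$ (r, c)"
    unfolding basis_combination_def index_mat(1)[OF rc] prod.case
  proof (rule sum.cong[OF refl])
    fix j assume j: "j \<in> {0..N}"
    have "rat_recip (b_rat \<sigma> \<xi> \<beta> j) = rat_const (1 / \<beta> 0) *
        (\<Prod>k = 1..j. rev1 (to_fract (h_poly \<sigma> (k - 1))) / rev1 (to_fract (g_poly \<beta> \<xi> k)))"
      by (simp add: b_rat_def rat_recip_mult rat_recip_prod rev1_divide)
    also have "(\<Prod>k = 1..j. rev1 (to_fract (h_poly \<sigma> (k - 1))) / rev1 (to_fract (g_poly \<beta> \<xi> k))) =
        inverse (\<Prod>k = 1..N. rev1 (to_fract (g_poly \<beta> \<xi> k))) * (\<Prod>k<j. rev1 (to_fract (h_poly \<sigma> k))) *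
        (\<Prod>k\<in>{j<..N}. rev1 (to_fract (g_poly \<beta> \<xi> k)))"
      using j g by (intro scaled_basis_function) auto
    finally show "rat_var ^ e * (rat_recip (b_rat \<sigma> \<xi> \<beta> j) * rat_const (D j $$ (r, c))) =
      rat_var ^ e * (rat_const (1 / \<beta> 0) * inverse (\<Prod>k = 1..N. rev1 (to_fract (g_poly \<beta> \<xi> k)))) *
      (\<Prod>k<j. rev1 (to_fract (h_poly \<sigma> k))) * (\<Prod>k\<in>{j<..N}. rev1 (to_fract (g_poly \<beta> \<xi> k))) *
      map_mat rat_const (D j) $$ (r, c)"
      using rc bspec[OF D j] by (simp add: mult.assoc)
  qed
  finally show "?L $$ (r, c) = ?R $$ (r, c)" .
qed

section \<open>The pencil\<close>

lemma degree_h_poly [simp]: "degree (h_poly \<sigma> j) = 1"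
  by (simp add: h_poly_def)

lemma degree_g_poly_le: "degree (g_poly \<beta> \<xi> k) \<le> 1"
  unfolding g_poly_def by (rule order_trans[OF degree_smult_le]) simp

context
  fixes m N :: nat and \<sigma> :: "nat \<Rightarrow> 'a :: field" and \<xi> :: "nat \<Rightarrow> 'a option" and \<beta> :: "nat \<Rightarrow> 'a"
    and D :: "nat \<Rightarrow> 'a mat"
  assumes N: "N \<ge> 2"
    and \<xi>: "\<And>i. i \<in> {1..N} \<Longrightarrow> \<xi> i \<noteq> Some 0"
    and \<beta>: "\<And>i. i \<in> {0..N} \<Longrightarrow> \<beta> i \<noteq> 0"
    and D: "\<forall>i\<in>{0..N}. D i \<in> carrier_mat m m"
begin

section \<open>Size and degree of the pencil\<close>

lemma L_mat_size: "m + (N - 1) * m = N * m"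
  using N by (cases N) auto

lemma int_L_mat_size: "int ((N - 1) * m) = int (N * m) - int m"
  using L_mat_size by linarith

lemma L_mat_carrier: "L_mat m N \<sigma> \<xi> \<beta> D \<in> carrier_mat (N * m) (N * m)"
  using carrier_append_rows[OF M_mat_carrier[of m N \<sigma> \<xi> \<beta> D] K_mat_carrier[of m N \<sigma> \<xi> \<beta>]]
  unfolding L_mat_def L_mat_size .

lemma degree_L_mat_le:
  assumes "i < N * m" "j < N * m"
  shows "degree (L_mat m N \<sigma> \<xi> \<beta> D $$ (i, j)) \<le> 1"
proof (cases "i < m")
  case True
  have "L_mat m N \<sigma> \<xi> \<beta> D $$ (i, j) = M_mat m N \<sigma> \<xi> \<beta> D $$ (i, j)"
    using assms True L_mat_size
    by (simp add: L_mat_def append_rows_def carrier_matD[OF M_mat_carrier] carrier_matD[OF K_mat_carrier])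
  moreover have "degree (M_mat m N \<sigma> \<xi> \<beta> D $$ (i, j)) \<le> 1"
    unfolding M_mat_index[OF True assms(2) D]
    by (intro degree_add_le order_trans[OF degree_smult_le] degree_g_poly_le)
       (auto intro!: order_trans[OF degree_smult_le])
  ultimately show ?thesis by simp
next
  case False
  hence i: "i - m < (N - 1) * m"
    using assms L_mat_size by linarith
  have "L_mat m N \<sigma> \<xi> \<beta> D $$ (i, j) = K_mat m N \<sigma> \<xi> \<beta> $$ (i - m, j)"
    using assms False i L_mat_size
    by (simp add: L_mat_def append_rows_def carrier_matD[OF M_mat_carrier] carrier_matD[OF K_mat_carrier])
  thus ?thesis
    by (simp add: K_mat_index[OF i assms(2)] degree_g_poly_le[unfolded One_nat_def])
qed

lemma is_pencil_L_mat: "is_pencil (L_mat m N \<sigma> \<xi> \<beta> D)"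
  using degree_L_mat_le L_mat_carrier by (auto simp: is_pencil_def)

text \<open>The top left entry of \<open>K_mat\<close>, the negative of h_0, has degree exactly 1
  whatever the data. It is present because \<open>N \<ge> 2\<close> and
  \<open>m > 0\<close>.\<close>

lemma poly_mat_degree_L_mat:
  assumes "m > 0"
  shows "poly_mat_degree (L_mat m N \<sigma> \<xi> \<beta> D) = 1"
proof -
  let ?L = "L_mat m N \<sigma> \<xi> \<beta> D"
  let ?S = "{degree (?L $$ (i, j)) | i j. i < dim_row ?L \<and> j < dim_col ?L}"
  have S: "?S \<subseteq> {..1}"
    using degree_L_mat_le L_mat_carrier by auto
  have "0 < (N - 1) * m" "m < N * m"
    using assms N by auto
  hence "?L $$ (m, 0) = - h_poly \<sigma> 0"
    using assms L_mat_size K_mat_index[of 0 N m 0]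
    by (simp add: L_mat_def append_rows_def carrier_matD[OF M_mat_carrier] carrier_matD[OF K_mat_carrier])
  hence "degree (?L $$ (m, 0)) = 1"
    by simp
  moreover have "m < dim_row ?L" "0 < dim_col ?L"
    using \<open>m < N * m\<close> assms N L_mat_carrier by auto
  ultimately have "1 \<in> ?S"
    by force
  moreover have "finite ?S"
    using S by (rule finite_subset) simp
  ultimately show ?thesis
    unfolding poly_mat_degree_def using S by (intro Max_eqI) auto
qed

lemma rev_mat_L_mat:
  "rev_mat (int (poly_mat_degree (L_mat m N \<sigma> \<xi> \<beta> D))) (rat_mat (L_mat m N \<sigma> \<xi> \<beta> D)) =
    map_mat rev1 (rat_mat (M_mat m N \<sigma> \<xi> \<beta> D)) @\<^sub>r map_mat rev1 (rat_mat (K_mat m N \<sigma> \<xi> \<beta>))"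
proof -
  have "rev_mat (int (poly_mat_degree (L_mat m N \<sigma> \<xi> \<beta> D))) (rat_mat (L_mat m N \<sigma> \<xi> \<beta> D)) =
      map_mat rev1 (rat_mat (L_mat m N \<sigma> \<xi> \<beta> D))"
  \<comment> \<open>For \<open>m = 0\<close> the degree is 0 by convention, but then there is no
    entry to reverse.\<close>
  proof (cases "m = 0")
    case True
    thus ?thesis
      using L_mat_carrier by (intro eq_matI) (auto simp: rev_mat_def)
  next
    case False
    thus ?thesis
      by (simp add: poly_mat_degree_L_mat rev_mat_1)
  qed
  also have "\<dots> = map_mat rev1 (rat_mat (M_mat m N \<sigma> \<xi> \<beta> D)) @\<^sub>r map_mat rev1 (rat_mat (K_mat m N \<sigma> \<xi> \<beta>))"
    unfolding L_mat_def map_append_rows[OF M_mat_carrier K_mat_carrier]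
    by (rule map_append_rows[of _ m "N * m" _ "(N - 1) * m"]) (simp_all only: map_carrier_mat M_mat_carrier K_mat_carrier)
  finally show ?thesis .
qed

private abbreviation (input) "\<gamma> k \<equiv> to_fract (g_poly \<beta> \<xi> k)"
private abbreviation (input) "\<eta> k \<equiv> to_fract (h_poly \<sigma> k)"
private abbreviation (input) "K \<equiv> rat_mat (K_mat m N \<sigma> \<xi> \<beta>)"
private abbreviation (input) "M \<equiv> rat_mat (M_mat m N \<sigma> \<xi> \<beta> D)"
private abbreviation (input) "Q \<equiv> Q_mat m N \<sigma> \<xi> \<beta> D"

text \<open>The factor \<beta>_N cancels the division by \<beta>_N in \<open>M_mat\<close>; the rest
  is the common factor of Q_N in \<open>Q_mat_eq\<close>.\<close>

definition dual_at_poles_complement :: "'a poly fract mat" where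
  "dual_at_poles_complement = kronecker_mat (column_mat N (dual_coeff N \<gamma> \<eta>
     (rat_const (\<beta> N) * (rat_const (1 / \<beta> 0) * inverse (\<Prod>k = 1..N. \<gamma> k))))) (1\<^sub>m m)"

text \<open>The same construction from the reversed factors, with the power of
  \<open>rat_var\<close> that the grade contributes in \<open>rev_Q_mat_eq\<close>.\<close>

definition dual_at_infinity :: "'a poly fract mat" where
  "dual_at_infinity = kronecker_mat (column_mat N (dual_coeff N (\<lambda>k. rev1 (\<gamma> k)) (\<lambda>k. rev1 (\<eta> k))
     (rat_const (\<beta> N) * (rat_var ^ num_infinite_poles N \<xi> *
       (rat_const (1 / \<beta> 0) * inverse (\<Prod>k = 1..N. rev1 (\<gamma> k))))))) (1\<^sub>m m)"

section \<open>Points outside the finite poles\<close>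

lemma unit_at_g_poly:
  assumes "x \<notin> finite_poles N \<xi>" "k \<in> {1..N}"
  shows "unit_at (\<gamma> k) x"
proof -
  have "poly (g_poly \<beta> \<xi> k) x \<noteq> 0"
    using assms \<xi>[of k] \<beta>[of k]
    by (cases "\<xi> k") (auto simp: g_poly_def pole_recip_def finite_poles_def field_simps)
  thus ?thesis
    by (simp add: unit_at_def)
qed

text \<open>The point 0 is always available as a sample point from which generic facts, such as
  normal rank and nonvanishing of the g_k, are deduced.\<close>

lemma zero_not_finite_pole: "0 \<notin> finite_poles N \<xi>"
  using \<xi> by (auto simp: finite_poles_def)

lemma K_eq: "K = kronecker_mat (bidiagonal_mat N \<gamma> \<eta>) (1\<^sub>m m)"
  unfolding K_mat_eq by (rule map_kronecker_bidiagonal) simp_all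

text \<open>The \<gamma> are units here, while \<eta> may vanish because \<open>x\<close> may be a
  node. Hence the pivot is 0: the coefficient of index 0 contains no \<eta>.\<close>

lemma dual_completion_poles_complement:
  assumes x: "x \<notin> finite_poles N \<xi>"
  shows "dual_completion_at m ((N - 1) * m) K dual_at_poles_complement x"
proof -
  define c where "c = rat_const (\<beta> N) * (rat_const (1 / \<beta> 0) * inverse (\<Prod>k = 1..N. \<gamma> k))"
  have c: "unit_at c x"
    unfolding c_def using \<beta>[of 0] \<beta>[of N] unit_at_g_poly[OF x]
    by (intro unit_at_mult unit_at_const unit_at_inverse unit_at_prod) auto
  show ?thesis
    unfolding K_eq dual_at_poles_complement_def c_def[symmetric]
  proof (rule dual_completion_bidiagonal[where p = 0])
    show "unit_at (dual_coeff N \<gamma> \<eta> c 0) x"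
      using c unit_at_g_poly[OF x] by (auto simp: dual_coeff_def intro!: unit_at_mult unit_at_prod)
    show "\<not> has_pole_at (dual_coeff N \<gamma> \<eta> c j) x" if "j < N" for j
      by (rule no_pole_dual_coeff[OF unit_at_no_pole[OF c] _ _ that]) simp_all
  qed (use N unit_at_g_poly[OF x] dual_coeff_rec[of _ N \<gamma>] in auto)
qed

lemma M_mult_dual_poles_complement: "M * dual_at_poles_complement = Q"
proof -
  have D': "\<forall>i\<in>{0..N}. map_mat rat_const (D i) \<in> carrier_mat m m"
    using D by simp
  have "rat_const (\<beta> N) \<noteq> 0"
    using \<beta>[of N] unit_at_nonzero[OF unit_at_const[of "\<beta> N"]] by auto
  moreover have "\<forall>k\<in>{1..N}. g_poly \<beta> \<xi> k \<noteq> 0"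
    using unit_at_nonzero[OF unit_at_g_poly[OF zero_not_finite_pole]] by simp
  ultimately show ?thesis
    unfolding rat_M_mat[OF D] dual_at_poles_complement_def
    using N first_block_row_mult_dual[OF _ _ D'] Q_mat_eq[OF D] by simp
qed

section \<open>The point at infinity\<close>

lemma rev1_g_poly: "rev1 (\<gamma> k) = to_fract (smult (\<beta> k) [:- pole_recip (\<xi> k), 1:])"
  using rev1_linear[of "\<beta> k" "- \<beta> k * pole_recip (\<xi> k)"] by (simp add: g_poly_def)

lemma rev1_h_poly: "rev1 (\<eta> k) = to_fract [:1, - \<sigma> k:]"
  using rev1_linear[of "- \<sigma> k" 1] by (simp add: h_poly_def)

lemma rev1_g_poly_nonzero: "\<forall>k\<in>{1..N}. rev1 (\<gamma> k) \<noteq> 0"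
  using \<beta> by (simp add: rev1_g_poly)

lemma rev1_K: "map_mat rev1 K = kronecker_mat (bidiagonal_mat N (\<lambda>k. rev1 (\<gamma> k)) (\<lambda>k. rev1 (\<eta> k))) (1\<^sub>m m)"
  unfolding K_eq by (rule map_kronecker_bidiagonal) (simp_all add: rev1_uminus)

lemma unit_at_infinity_factor:
  "unit_at (rat_var ^ num_infinite_poles N \<xi> * inverse (\<Prod>k = 1..N. rev1 (\<gamma> k))) 0"
proof -
  \<comment> \<open>\<open>u k\<close> is the reversed g_k with its zero at 0 removed: for an
    infinite pole the reversal is \<beta>_k times the variable, and for a finite one its value at 0
    is -\<beta>_k / \<xi>_k, which is nonzero.\<close>
  define u where "u = (\<lambda>k. if \<xi> k = None then rat_const (\<beta> k) else rev1 (\<gamma> k))"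
  have u: "unit_at (u k) 0" if "k \<in> {1..N}" for k
    using \<beta>[of k] \<xi>[OF that] that
    by (auto simp: u_def unit_at_const rev1_g_poly unit_at_def pole_recip_def)
  have "rev1 (\<gamma> k) = (if \<xi> k = None then rat_var else 1) * u k" for k
  proof (cases "\<xi> k = None")
    case True
    hence "rev1 (\<gamma> k) = rat_var * rat_const (\<beta> k)"
      unfolding rev1_g_poly rat_var_def rat_const_def to_fract_mult[symmetric]
      by (simp add: pole_recip_def)
    with True show ?thesis
      by (simp add: u_def)
  next
    case False
    thus ?thesis
      by (simp add: u_def del: not_None_eq)
  qed
  hence "(\<Prod>k = 1..N. rev1 (\<gamma> k)) = (\<Prod>k = 1..N. if \<xi> k = None then rat_var else 1) * prod u {1..N}"
    by (simp add: prod.distrib)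
  also have "(\<Prod>k = 1..N. if \<xi> k = None then rat_var else 1 :: 'a poly fract) = rat_var ^ num_infinite_poles N \<xi>"
    unfolding num_infinite_poles_def by (simp flip: prod.inter_filter)
  finally have "rat_var ^ num_infinite_poles N \<xi> * inverse (\<Prod>k = 1..N. rev1 (\<gamma> k)) = inverse (prod u {1..N})"
    by simp
  thus ?thesis
    using unit_at_inverse[OF unit_at_prod[of "{1..N}" u, OF u]] by simp
qed

text \<open>The roles are exchanged: the reversed \<eta> have value 1 at 0, while a reversed
  \<gamma> vanishes there at an infinite pole. Hence the pivot is \<open>N - 1\<close>, whose
  coefficient contains no \<gamma> beyond those in \<open>c\<close>.\<close>

lemma dual_completion_infinity:
  "dual_completion_at m ((N - 1) * m) (map_mat rev1 K) dual_at_infinity 0"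
proof -
  define c where "c = rat_const (\<beta> N) * (rat_var ^ num_infinite_poles N \<xi> *
       (rat_const (1 / \<beta> 0) * inverse (\<Prod>k = 1..N. rev1 (\<gamma> k))))"
  have "c = rat_const (\<beta> N) * (rat_const (1 / \<beta> 0) *
      (rat_var ^ num_infinite_poles N \<xi> * inverse (\<Prod>k = 1..N. rev1 (\<gamma> k))))"
    by (simp add: c_def mult_ac)
  also have "unit_at \<dots> 0"
    using \<beta>[of 0] \<beta>[of N] by (intro unit_at_mult unit_at_const unit_at_infinity_factor) auto
  finally have c: "unit_at c 0" .
  have \<eta>: "unit_at (rev1 (\<eta> k)) 0" for k
    by (simp add: rev1_h_poly unit_at_def)
  have \<gamma>: "\<not> has_pole_at (rev1 (\<gamma> k)) 0" for k
    by (simp add: rev1_g_poly)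
  show ?thesis
    unfolding rev1_K dual_at_infinity_def c_def[symmetric]
  proof (rule dual_completion_bidiagonal[where p = "N - 1"])
    have "{N - 1<..<N} = {}" by auto
    thus "unit_at (dual_coeff N (\<lambda>k. rev1 (\<gamma> k)) (\<lambda>k. rev1 (\<eta> k)) c (N - 1)) 0"
      using c \<eta> by (auto simp: dual_coeff_def intro!: unit_at_mult unit_at_prod)
  next
    fix i assume "i < N - 1"
    thus "rev1 (\<gamma> (i + 1)) * dual_coeff N (\<lambda>k. rev1 (\<gamma> k)) (\<lambda>k. rev1 (\<eta> k)) c (i + 1) =
      rev1 (\<eta> i) * dual_coeff N (\<lambda>k. rev1 (\<gamma> k)) (\<lambda>k. rev1 (\<eta> k)) c i"
      by (rule dual_coeff_rec)
  next
    fix j assume "j < N"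
    thus "\<not> has_pole_at (dual_coeff N (\<lambda>k. rev1 (\<gamma> k)) (\<lambda>k. rev1 (\<eta> k)) c j) 0"
      by (intro no_pole_dual_coeff unit_at_no_pole[OF c] unit_at_no_pole[OF \<eta>] \<gamma>)
  qed (use N \<gamma> \<eta> unit_at_no_pole[OF \<eta>] in auto)
qed

lemma rev1_M_mult_dual_infinity:
  "map_mat rev1 M * dual_at_infinity = rev_mat (int (num_infinite_poles N \<xi>)) Q"
proof -
  have D': "\<forall>i\<in>{0..N}. map_mat rat_const (D i) \<in> carrier_mat m m"
    using D by simp
  have "rat_const (\<beta> N) \<noteq> 0"
    using \<beta>[of N] unit_at_nonzero[OF unit_at_const[of "\<beta> N"]] by auto
  thus ?thesis
    unfolding rat_M_mat[OF D] rev1_first_block_row[OF D] dual_at_infinity_def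
      rev_Q_mat_eq[OF D rev1_g_poly_nonzero]
    using N by (intro first_block_row_mult_dual[OF _ _ D']) auto
qed

section \<open>Assembly of the three claims\<close>

lemma block_full_rank_pencil_L_mat:
  "block_full_rank_pencil_one_col (L_mat m N \<sigma> \<xi> \<beta> D) (M_mat m N \<sigma> \<xi> \<beta> D) (K_mat m N \<sigma> \<xi> \<beta>)"
  unfolding block_full_rank_pencil_one_col_def
  using is_pencil_L_mat M_mat_carrier[of m N \<sigma> \<xi> \<beta> D] K_mat_carrier[of m N \<sigma> \<xi> \<beta>]
    dual_completion_full_rank(2)[OF dual_completion_poles_complement[OF zero_not_finite_pole]]
  by (auto simp: L_mat_def)

lemma associated_with_L_mat:
  "associated_with_in (M_mat m N \<sigma> \<xi> \<beta> D) (K_mat m N \<sigma> \<xi> \<beta>) Q (UNIV - finite_poles N \<xi>)"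
proof -
  \<comment> \<open>One basis serves all points at once, as \<open>dual_at_poles_complement\<close>
    does not depend on \<open>x\<close>. The matrix \<open>N\<^sub>2\<close> is the
    identity.\<close>
  let ?N = "transpose_mat dual_at_poles_complement"
  note compl = dual_completion_poles_complement
  have Nt: "dual_at_poles_complement \<in> carrier_mat (N * m) m"
    and KN: "K * dual_at_poles_complement = 0\<^sub>m ((N - 1) * m) m"
    using compl[OF zero_not_finite_pole] unfolding dual_completion_at_def L_mat_size by blast+
  have K: "K \<in> carrier_mat ((N - 1) * m) (N * m)" and M: "M \<in> carrier_mat m (N * m)"
    using K_mat_carrier M_mat_carrier by auto
  have "dual_rational_basis K ?N"
    unfolding dual_rational_basis_def
    using Nt K KN L_mat_size dual_completion_full_rank(4)[OF compl[OF zero_not_finite_pole]] by auto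
  moreover have "full_row_rank_in K (UNIV - finite_poles N \<xi>)"
    unfolding full_row_rank_in_def using dual_completion_full_rank(1)[OF compl] K by auto
  moreover have "full_row_rank_in ?N (UNIV - finite_poles N \<xi>)"
    unfolding full_row_rank_in_def
    using dual_completion_full_rank(3)[OF compl] Nt compl by (auto simp: dual_completion_at_def)
  moreover have "Q = 1\<^sub>m m * M * transpose_mat ?N"
    using M by (simp add: M_mult_dual_poles_complement)
  moreover have "dim_row (M_mat m N \<sigma> \<xi> \<beta> D) = m"
    using M by simp
  ultimately show ?thesis
    unfolding associated_with_in_def by (intro exI[of _ ?N] exI[of _ "1\<^sub>m m"]) simp
qed

lemma Q_mat_carrier: "Q \<in> carrier_mat m m"
  by (simp add: Q_mat_def)

lemma linearization_L_mat:
  "linearization_empty_state_in (L_mat m N \<sigma> \<xi> \<beta> D) Q (UNIV - finite_poles N \<xi>)"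
  unfolding linearization_empty_state_in_def
proof (intro conjI ballI)
  show "is_pencil (L_mat m N \<sigma> \<xi> \<beta> D)"
    by (rule is_pencil_L_mat)
  fix x assume "x \<in> UNIV - finite_poles N \<xi>"
  hence x: "x \<notin> finite_poles N \<xi>" by simp
  have M: "M \<in> carrier_mat m (m + (N - 1) * m)"
    using M_mat_carrier unfolding L_mat_size by auto
  obtain R\<^sub>1 R\<^sub>2 where R: "R\<^sub>1 \<in> carrier_mat (m + (N - 1) * m) (m + (N - 1) * m)"
      "R\<^sub>2 \<in> carrier_mat (m + (N - 1) * m) (m + (N - 1) * m)" "regular_at R\<^sub>1 x" "regular_at R\<^sub>2 x"
      "R\<^sub>1 * diag_block_mat [M * dual_at_poles_complement, 1\<^sub>m ((N - 1) * m)] * R\<^sub>2 = M @\<^sub>r K"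
    using dual_completion_equivalence[OF dual_completion_poles_complement[OF x] M no_entry_pole_rat_mat] .
  have "M @\<^sub>r K = diag_block_mat [rat_mat (L_mat m N \<sigma> \<xi> \<beta> D), 1\<^sub>m 0]"
    unfolding diag_block_mat_one_0 L_mat_def map_append_rows[OF M_mat_carrier K_mat_carrier] ..
  note facts = this R[unfolded M_mult_dual_poles_complement] L_mat_carrier Q_mat_carrier L_mat_size int_L_mat_size
  show "\<exists>s\<^sub>1 s\<^sub>2 R\<^sub>1 R\<^sub>2.
        int s\<^sub>1 - int s\<^sub>2 = int (dim_row (L_mat m N \<sigma> \<xi> \<beta> D)) - int (dim_row Q) \<and>
        int s\<^sub>1 - int s\<^sub>2 = int (dim_col (L_mat m N \<sigma> \<xi> \<beta> D)) - int (dim_col Q) \<and>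
        R\<^sub>1 \<in> carrier_mat (dim_row Q + s\<^sub>1) (dim_row Q + s\<^sub>1) \<and>
        R\<^sub>2 \<in> carrier_mat (dim_col Q + s\<^sub>1) (dim_col Q + s\<^sub>1) \<and>
        regular_at R\<^sub>1 x \<and> regular_at R\<^sub>2 x \<and>
        R\<^sub>1 * diag_block_mat [Q, 1\<^sub>m s\<^sub>1] * R\<^sub>2 = diag_block_mat [rat_mat (L_mat m N \<sigma> \<xi> \<beta> D), 1\<^sub>m s\<^sub>2]"
    \<comment> \<open>Padding Q_N with \<open>(N - 1) * m\<close> unit rows and columns gives
      exactly the size of the pencil, so \<open>s\<^sub>2\<close> is 0.\<close>
    by (rule exI[of _ "(N - 1) * m"], rule exI[of _ 0], rule exI[of _ R\<^sub>1], rule exI[of _ R\<^sub>2])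
       (use facts in \<open>simp del: diag_block_mat.simps\<close>)
qed

lemma linearization_L_mat_infinity:
  "linearization_empty_state_at_infinity (L_mat m N \<sigma> \<xi> \<beta> D) Q (int (num_infinite_poles N \<xi>))"
  unfolding linearization_empty_state_at_infinity_def
proof (intro conjI)
  show "is_pencil (L_mat m N \<sigma> \<xi> \<beta> D)"
    by (rule is_pencil_L_mat)
  have M: "map_mat rev1 M \<in> carrier_mat m (m + (N - 1) * m)"
    using M_mat_carrier unfolding L_mat_size by auto
  \<comment> \<open>The entries of the reversed first block row are polynomials up to division by
    the nonzero constant \<beta>_N.\<close>
  have np: "no_entry_pole_at (map_mat rev1 M) 0"
    unfolding rat_M_mat[OF D] rev1_first_block_row[OF D]
  proof (rule no_entry_pole_atI)
    have D': "\<forall>i\<in>{0..N}. map_mat rat_const (D i) \<in> carrier_mat m m"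
      using D by simp
    have b: "unit_at (rat_const (\<beta> N)) 0"
      using \<beta>[of N] by (simp add: unit_at_const)
    let ?F = "first_block_row m N (\<lambda>k. rev1 (\<gamma> k)) (\<lambda>k. rev1 (\<eta> k)) (rat_const (\<beta> N)) (\<lambda>i. map_mat rat_const (D i))"
    fix r c assume "r < dim_row ?F" "c < dim_col ?F"
    hence rc: "r < m" "c < N * m" by (simp_all add: carrier_matD[OF first_block_row_carrier])
    have cd: "c div m < N" "c mod m < m"
      using rc by (auto simp: less_mult_imp_div_less)
    have "D (c div m) \<in> carrier_mat m m" "D N \<in> carrier_mat m m"
      using D cd by auto
    thus "\<not> has_pole_at (?F $$ (r, c)) 0"
      unfolding first_block_row_index[OF rc D'] using rc cd b
      by (simp add: rev1_g_poly rev1_h_poly no_pole_divide)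
  qed
  obtain R\<^sub>1 R\<^sub>2 where R: "R\<^sub>1 \<in> carrier_mat (m + (N - 1) * m) (m + (N - 1) * m)"
      "R\<^sub>2 \<in> carrier_mat (m + (N - 1) * m) (m + (N - 1) * m)" "regular_at R\<^sub>1 0" "regular_at R\<^sub>2 0"
      "R\<^sub>1 * diag_block_mat [map_mat rev1 M * dual_at_infinity, 1\<^sub>m ((N - 1) * m)] * R\<^sub>2 =
        map_mat rev1 M @\<^sub>r map_mat rev1 K"
    using dual_completion_equivalence[OF dual_completion_infinity M np] .
  have "map_mat rev1 M @\<^sub>r map_mat rev1 K = diag_block_mat
      [rev_mat (int (poly_mat_degree (L_mat m N \<sigma> \<xi> \<beta> D))) (rat_mat (L_mat m N \<sigma> \<xi> \<beta> D)), 1\<^sub>m 0]"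
    unfolding diag_block_mat_one_0 rev_mat_L_mat ..
  note facts = this R[unfolded rev1_M_mult_dual_infinity] L_mat_carrier Q_mat_carrier L_mat_size int_L_mat_size
  show "\<exists>s\<^sub>1 s\<^sub>2 R\<^sub>1 R\<^sub>2.
        int s\<^sub>1 - int s\<^sub>2 = int (dim_row (L_mat m N \<sigma> \<xi> \<beta> D)) - int (dim_row Q) \<and>
        int s\<^sub>1 - int s\<^sub>2 = int (dim_col (L_mat m N \<sigma> \<xi> \<beta> D)) - int (dim_col Q) \<and>
        R\<^sub>1 \<in> carrier_mat (dim_row Q + s\<^sub>1) (dim_row Q + s\<^sub>1) \<and>
        R\<^sub>2 \<in> carrier_mat (dim_col Q + s\<^sub>1) (dim_col Q + s\<^sub>1) \<and>
        regular_at R\<^sub>1 0 \<and> regular_at R\<^sub>2 0 \<and>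
        R\<^sub>1 * diag_block_mat [rev_mat (int (num_infinite_poles N \<xi>)) Q, 1\<^sub>m s\<^sub>1] * R\<^sub>2 =
          diag_block_mat [rev_mat (int (poly_mat_degree (L_mat m N \<sigma> \<xi> \<beta> D))) (rat_mat (L_mat m N \<sigma> \<xi> \<beta> D)), 1\<^sub>m s\<^sub>2]"
    by (rule exI[of _ "(N - 1) * m"], rule exI[of _ 0], rule exI[of _ R\<^sub>1], rule exI[of _ R\<^sub>2])
       (use facts in \<open>simp del: diag_block_mat.simps\<close>)
qed

end

theorem theorem6p1:
  fixes m N :: nat
    and \<sigma> :: "nat \<Rightarrow> 'a :: alg_closed_field"
    and \<xi> :: "nat \<Rightarrow> 'a option"
    and \<beta> :: "nat \<Rightarrow> 'a"
    and D :: "nat \<Rightarrow> 'a mat"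
  assumes "N \<ge> 2"
    and "\<And>i. i \<in> {1..N} \<Longrightarrow> \<xi> i \<noteq> Some 0"
    and "\<And>i. i \<in> {0..N} \<Longrightarrow> \<beta> i \<noteq> 0"
    and "\<And>i. i \<in> {0..N} \<Longrightarrow> D i \<in> carrier_mat m m"
  shows
    "(block_full_rank_pencil_one_col
        (L_mat m N \<sigma> \<xi> \<beta> D) (M_mat m N \<sigma> \<xi> \<beta> D) (K_mat m N \<sigma> \<xi> \<beta>) \<and>
      associated_with_in (M_mat m N \<sigma> \<xi> \<beta> D) (K_mat m N \<sigma> \<xi> \<beta>)
        (Q_mat m N \<sigma> \<xi> \<beta> D) (UNIV - finite_poles N \<xi>)) \<and>
     linearization_empty_state_in
        (L_mat m N \<sigma> \<xi> \<beta> D) (Q_mat m N \<sigma> \<xi> \<beta> D) (UNIV - finite_poles N \<xi>) \<and>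
     linearization_empty_state_at_infinity
        (L_mat m N \<sigma> \<xi> \<beta> D) (Q_mat m N \<sigma> \<xi> \<beta> D) (int (num_infinite_poles N \<xi>))"
  by (intro conjI block_full_rank_pencil_L_mat associated_with_L_mat linearization_L_mat
        linearization_L_mat_infinity) (use assms in auto)

end
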